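(* Let $n\ge1$, let $\mathcal{J}_n$ be the ideal of $\mathbb{Q}[x_1,\ldots,x_n]$ generated by all non-constant quasi-symmetric polynomials in $x_1,\ldots,x_n$, let $R_n=\mathbb{Q}[x_1,\ldots,x_n]/\mathcal{J}_n$, and let $SH_n=\mathcal{J}_n^{\perp}$ be the orthogonal complement of $\mathcal{J}_n$ with respect to the scalar product $\langle P,Q\rangle=\big(P(\partial_{x_1},\ldots,\partial_{x_n})Q\big)(0,\ldots,0)$. Then $$\dim SH_n=\dim R_n\le C_n=\frac{1}{n+1}\binom{2n}{n}.$$
   Context: For a composition $\alpha=[\alpha_1,\ldots,\alpha_k]$ of $d$ (finite sequence of positive integers with sum $d$) let $D(\alpha)=\{\alpha_1,\alpha_1+\alpha_2,\ldots,\alpha_1+\cdots+\alpha_{k-1}\}$ and $F_\alpha(x_1,\ldots,x_n)=\sum x_{j_1}\cdots x_{j_d}$ over $1\le j_1\le\cdots\le j_d\le n$ with $j_i<j_{i+1}$ whenever $i\in D(\alpha)$. Quasi-symmetric polynomials in $n$ variables are the $\mathbb{Q}$-span of these $F_\alpha(x_1,\ldots,x_n)$ (together with $1$); the non-constant ones are spanned by those with $d>0$. *)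

theory Defs
  imports
    "HOL-Library.Poly_Mapping"
    "HOL-Algebra.QuotRing"
    "HOL-Algebra.Embedded_Algebras"
begin

section \<open>Polynomials over the rationals\<close>

text \<open>
  A polynomial in the variables \<open>x\<^sub>0, x\<^sub>1, x\<^sub>2, \<dots>\<close> maps exponent vectors to coefficients; its
  multiplication is the convolution product of \<^theory>\<open>HOL-Library.Poly_Mapping\<close>.
\<close>

type_synonym rpoly = "(nat \<Rightarrow>\<^sub>0 nat) \<Rightarrow>\<^sub>0 rat"

definition const :: "rat \<Rightarrow> rpoly" where
  "const c = Poly_Mapping.single 0 c"

definition var :: "nat \<Rightarrow> rpoly" where
  "var i = Poly_Mapping.single (Poly_Mapping.single i 1) 1"

definition eval :: "(nat \<Rightarrow> rat) \<Rightarrow> rpoly \<Rightarrow> rat" where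
  "eval a p = (\<Sum>m\<in>Poly_Mapping.keys p. Poly_Mapping.lookup p m *
                 (\<Prod>i\<in>Poly_Mapping.keys m. a i ^ Poly_Mapping.lookup m i))"

text \<open>The ring \<open>\<rat>[x\<^sub>1, \<dots>, x\<^sub>n]\<close> and its subfield of constants.\<close>

definition poly_ring :: "nat \<Rightarrow> rpoly ring" where
  "poly_ring n =
     \<lparr>carrier = {p. \<forall>m\<in>Poly_Mapping.keys p. Poly_Mapping.keys m \<subseteq> {1..n}},
      mult = (*), one = 1, zero = 0, add = (+)\<rparr>"

definition constants :: "rpoly set" where
  "constants = Set.range const"

section \<open>Quasi-symmetric polynomials\<close>

definition composition :: "nat \<Rightarrow> nat list \<Rightarrow> bool" where
  "composition d \<alpha> \<longleftrightarrow> (\<forall>a\<in>set \<alpha>. 0 < a) \<and> sum_list \<alpha> = d"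

definition partial_sums :: "nat list \<Rightarrow> nat set" where
  "partial_sums \<alpha> = (\<lambda>k. sum_list (take k \<alpha>)) ` {1..<length \<alpha>}"

text \<open>
  The index sequence \<open>j\<^sub>1, \<dots>, j\<^sub>d\<close> is a list counted from 0, so \<open>j\<^sub>i\<close> is \<open>js ! (i - 1)\<close>; elements of
  \<^const>\<open>partial_sums\<close> are at least 1 when \<open>\<alpha>\<close> is a composition.
\<close>

definition fundamental_qsym :: "nat \<Rightarrow> nat list \<Rightarrow> rpoly" where
  "fundamental_qsym n \<alpha> =
     (\<Sum>js \<in> {js. length js = sum_list \<alpha> \<and> set js \<subseteq> {1..n} \<and> sorted js \<and>
               (\<forall>i\<in>partial_sums \<alpha>. js ! (i - 1) < js ! i)}.
        \<Prod>j\<leftarrow>js. var j)"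

definition nonconst_qsym :: "nat \<Rightarrow> rpoly set" where
  "nonconst_qsym n =
     module.span (\<lambda>c p. const c * p) {fundamental_qsym n \<alpha> | \<alpha> d. 0 < d \<and> composition d \<alpha>}"

definition qsym_ideal :: "nat \<Rightarrow> rpoly set" where
  "qsym_ideal n = Idl\<^bsub>poly_ring n\<^esub> (nonconst_qsym n)"

definition qsym_quotient :: "nat \<Rightarrow> rpoly set ring" where
  "qsym_quotient n = poly_ring n Quot qsym_ideal n"

text \<open>The copy of \<open>\<rat>\<close> in the quotient, over which its dimension is taken.\<close>

definition quotient_constants :: "nat \<Rightarrow> rpoly set set" where
  "quotient_constants n = (\<lambda>p. qsym_ideal n +>\<^bsub>poly_ring n\<^esub> p) ` constants"

section \<open>Super-harmonic polynomials\<close>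

text \<open>
  In the partial derivative the truncated difference of exponents is harmless: where it truncates,
  the coefficient \<open>lookup m i\<close> vanishes.
\<close>

definition partial :: "nat \<Rightarrow> rpoly \<Rightarrow> rpoly" where
  "partial i q = (\<Sum>m\<in>Poly_Mapping.keys q.
     Poly_Mapping.single (m - Poly_Mapping.single i 1)
       (of_nat (Poly_Mapping.lookup m i) * Poly_Mapping.lookup q m))"

definition monomial_diff :: "(nat \<Rightarrow>\<^sub>0 nat) \<Rightarrow> rpoly \<Rightarrow> rpoly" where
  "monomial_diff m =
     foldr (\<lambda>i. partial i ^^ Poly_Mapping.lookup m i) (sorted_list_of_set (Poly_Mapping.keys m))"

definition diff_op :: "rpoly \<Rightarrow> rpoly \<Rightarrow> rpoly" where
  "diff_op p q =
     (\<Sum>m\<in>Poly_Mapping.keys p. const (Poly_Mapping.lookup p m) * monomial_diff m q)"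

definition scalar_product :: "rpoly \<Rightarrow> rpoly \<Rightarrow> rat" where
  "scalar_product p q = eval (\<lambda>_. 0) (diff_op p q)"

definition super_harmonic :: "nat \<Rightarrow> rpoly set" where
  "super_harmonic n =
     {q \<in> carrier (poly_ring n). \<forall>p\<in>qsym_ideal n. scalar_product p q = 0}"

section \<open>Well-definedness of the structures above\<close>

lemma vector_space_const_mult: "vector_space (\<lambda>c (p :: rpoly). const c * p)"
proof
  fix c d :: rat and p q :: rpoly
  show "const c * (p + q) = const c * p + const c * q"
    by (rule distrib_left)
  show "const (c + d) * p = const c * p + const d * p"
    by (simp add: const_def single_add distrib_right)
  show "const c * (const d * p) = const (c * d) * p"
    by (simp add: const_def mult_single flip: mult.assoc)
  show "const 1 * p = p"
    by (simp add: const_def)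
qed

lemma poly_ring_ops:
  "mult (poly_ring n) = (*)" "add (poly_ring n) = (+)"
  "one (poly_ring n) = 1" "zero (poly_ring n) = 0"
  by (simp_all add: poly_ring_def)

lemma mem_poly_ring:
  "p \<in> carrier (poly_ring n) \<longleftrightarrow> (\<forall>m\<in>Poly_Mapping.keys p. Poly_Mapping.keys m \<subseteq> {1..n})"
  by (simp add: poly_ring_def)

lemma const_in_poly_ring: "const c \<in> carrier (poly_ring n)"
  by (simp add: const_def mem_poly_ring)

lemma poly_ring_closed:
  "0 \<in> carrier (poly_ring n)" "1 \<in> carrier (poly_ring n)"
  "p \<in> carrier (poly_ring n) \<Longrightarrow> - p \<in> carrier (poly_ring n)"
  "p \<in> carrier (poly_ring n) \<Longrightarrow> q \<in> carrier (poly_ring n) \<Longrightarrow> p + q \<in> carrier (poly_ring n)"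
  "p \<in> carrier (poly_ring n) \<Longrightarrow> q \<in> carrier (poly_ring n) \<Longrightarrow> p * q \<in> carrier (poly_ring n)"
proof -
  show "0 \<in> carrier (poly_ring n)" "1 \<in> carrier (poly_ring n)"
    using const_in_poly_ring[of 0 n] const_in_poly_ring[of 1 n] by (simp_all add: const_def)
  show "p \<in> carrier (poly_ring n) \<Longrightarrow> - p \<in> carrier (poly_ring n)"
    by (simp add: mem_poly_ring)
  assume pq: "p \<in> carrier (poly_ring n)" "q \<in> carrier (poly_ring n)"
  show "p + q \<in> carrier (poly_ring n)"
    using pq Poly_Mapping.keys_add[of p q] unfolding mem_poly_ring by blast
  show "p * q \<in> carrier (poly_ring n)"
    unfolding mem_poly_ring
  proof
    fix m assume "m \<in> Poly_Mapping.keys (p * q)"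
    then obtain a b where "m = a + b" "a \<in> Poly_Mapping.keys p" "b \<in> Poly_Mapping.keys q"
      using Poly_Mapping.keys_mult[of p q] by blast
    then show "Poly_Mapping.keys m \<subseteq> {1..n}"
      using pq Poly_Mapping.keys_add[of a b] unfolding mem_poly_ring by blast
  qed
qed

lemma cring_poly_ring: "cring (poly_ring n)"
proof (rule cringI)
  show "abelian_group (poly_ring n)"
  proof (rule abelian_groupI)
    fix p assume p: "p \<in> carrier (poly_ring n)"
    show "\<exists>q\<in>carrier (poly_ring n). q \<oplus>\<^bsub>poly_ring n\<^esub> p = \<zero>\<^bsub>poly_ring n\<^esub>"
      by (rule bexI[of _ "- p"]) (simp_all add: poly_ring_ops poly_ring_closed p)
  qed (simp_all add: poly_ring_ops poly_ring_closed add.assoc add.commute)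
  show "comm_monoid (poly_ring n)"
    by (rule comm_monoidI)
      (simp_all add: poly_ring_ops poly_ring_closed mult.assoc mult.commute)
qed (simp add: poly_ring_ops distrib_right)

lemma a_inv_poly_ring:
  assumes "p \<in> carrier (poly_ring n)"
  shows "\<ominus>\<^bsub>poly_ring n\<^esub> p = - p"
proof -
  interpret cring "poly_ring n" by (rule cring_poly_ring)
  show ?thesis
    by (rule minus_equality) (simp_all add: assms poly_ring_closed poly_ring_ops)
qed

lemma subfield_constants: "subfield constants (poly_ring n)"
proof -
  interpret cring "poly_ring n" by (rule cring_poly_ring)
  have const: "const 1 = 1" "- const c = const (- c)" "const c * const d = const (c * d)"
    "const c + const d = const (c + d)" for c d
    by (simp_all add: const_def single_uminus mult_single single_add)
  have const_0: "const c = 0 \<longleftrightarrow> c = 0" for c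
    unfolding const_def by (metis lookup_single_eq lookup_zero single_zero)
  have subset: "constants \<subseteq> carrier (poly_ring n)"
    using const_in_poly_ring by (auto simp: constants_def)
  have subring: "subring constants (poly_ring n)"
  proof (rule subringI)
    show "\<one>\<^bsub>poly_ring n\<^esub> \<in> constants"
      unfolding poly_ring_ops constants_def const(1)[symmetric] by (rule rangeI)
  next
    fix p assume "p \<in> constants"
    then show "\<ominus>\<^bsub>poly_ring n\<^esub> p \<in> constants"
      using subset a_inv_poly_ring[of p n] by (auto simp: constants_def const)
  qed (use subset in \<open>auto simp: constants_def poly_ring_ops const\<close>)
  show ?thesis
  proof (rule subfieldI)
    show "subcring constants (poly_ring n)"
      using subcringI'[OF subring] .
    show "Units (poly_ring n \<lparr>carrier := constants\<rparr>) = constants - {\<zero>\<^bsub>poly_ring n\<^esub>}"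
    proof (intro equalityI subsetI)
      fix p assume "p \<in> Units (poly_ring n \<lparr>carrier := constants\<rparr>)"
      then show "p \<in> constants - {\<zero>\<^bsub>poly_ring n\<^esub>}"
        by (auto simp: Units_def poly_ring_ops)
    next
      fix p assume "p \<in> constants - {\<zero>\<^bsub>poly_ring n\<^esub>}"
      then obtain c where c: "p = const c" "c \<noteq> 0"
        by (auto simp: constants_def poly_ring_ops const_0)
      have "const (1 / c) * p = 1" "p * const (1 / c) = 1"
        using c by (simp_all add: const)
      then show "p \<in> Units (poly_ring n \<lparr>carrier := constants\<rparr>)"
        using c(1) by (auto simp: Units_def poly_ring_ops constants_def)
    qed
  qed
qed

lemma fundamental_qsym_carrier: "fundamental_qsym n \<alpha> \<in> carrier (poly_ring n)"
proof -
  have prod: "prod_list (map var js) \<in> carrier (poly_ring n)" if "set js \<subseteq> {1..n}" for js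
    using that
  proof (induction js)
    case (Cons j js)
    have "var j \<in> carrier (poly_ring n)"
      using Cons.prems by (simp add: var_def mem_poly_ring)
    then show ?case
      using Cons poly_ring_closed(5) by simp
  qed (simp add: poly_ring_closed)
  have sum: "sum f A \<in> carrier (poly_ring n)" if "\<And>x. x \<in> A \<Longrightarrow> f x \<in> carrier (poly_ring n)"
    for A :: "nat list set" and f
    using that
    by (induction A rule: infinite_finite_induct) (simp_all add: poly_ring_closed)
  show ?thesis
    unfolding fundamental_qsym_def by (rule sum) (use prod in auto)
qed

text \<open>
  The generators of the ideal have no constant term, so the ideal is proper and \<open>\<rat>\<close> embeds into the
  quotient.
\<close>

lemma fundamental_qsym_const_term:
  assumes "0 < sum_list \<alpha>"
  shows "0 \<notin> Poly_Mapping.keys (fundamental_qsym n \<alpha>)"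
proof -
  have prod: "0 \<notin> Poly_Mapping.keys (prod_list (map var js))" if js: "js \<noteq> []" for js
  proof (cases js)
    case (Cons j ks)
    show ?thesis
    proof
      assume "0 \<in> Poly_Mapping.keys (prod_list (map var js))"
      then obtain b where "0 = Poly_Mapping.single j (1 :: nat) + b"
        using Poly_Mapping.keys_mult[of "var j" "prod_list (map var ks)"] Cons
        by (auto simp: var_def)
      then have "0 = Poly_Mapping.lookup (Poly_Mapping.single j (1 :: nat) + b) j"
        by (metis lookup_zero)
      then show False
        by (simp add: lookup_add)
    qed
  qed (use js in simp)
  have "Poly_Mapping.lookup (fundamental_qsym n \<alpha>) 0 = 0"
    unfolding fundamental_qsym_def lookup_sum
  proof (rule sum.neutral, intro ballI)
    fix js assume "js \<in> {js. length js = sum_list \<alpha> \<and> set js \<subseteq> {1..n} \<and> sorted js \<and>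
                           (\<forall>i\<in>partial_sums \<alpha>. js ! (i - 1) < js ! i)}"
    then have "length js = sum_list \<alpha>" by blast
    then have "js \<noteq> []" using assms by (metis less_irrefl list.size(3))
    then show "Poly_Mapping.lookup (prod_list (map var js)) 0 = 0"
      using prod by (simp add: in_keys_iff)
  qed
  then show ?thesis
    by (simp add: in_keys_iff)
qed

lemma nonconst_qsym_subset:
  "nonconst_qsym n \<subseteq> {p \<in> carrier (poly_ring n). 0 \<notin> Poly_Mapping.keys p}"
proof -
  interpret vs: vector_space "\<lambda>c (p :: rpoly). const c * p" by (rule vector_space_const_mult)
  show ?thesis
    unfolding nonconst_qsym_def
  proof (rule vs.span_minimal)
    show "{fundamental_qsym n \<alpha> | \<alpha> d. 0 < d \<and> composition d \<alpha>}
            \<subseteq> {p \<in> carrier (poly_ring n). 0 \<notin> Poly_Mapping.keys p}"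
      using fundamental_qsym_carrier fundamental_qsym_const_term by (auto simp: composition_def)
    show "vs.subspace {p \<in> carrier (poly_ring n). 0 \<notin> Poly_Mapping.keys p}"
    proof (rule vs.subspaceI)
      fix c p assume p: "p \<in> {p \<in> carrier (poly_ring n). 0 \<notin> Poly_Mapping.keys p}"
      have "0 \<notin> Poly_Mapping.keys (const c * p)"
        using p Poly_Mapping.keys_mult[of "const c" p] by (auto simp: const_def split: if_splits)
      then show "const c * p \<in> {p \<in> carrier (poly_ring n). 0 \<notin> Poly_Mapping.keys p}"
        using p by (simp add: poly_ring_closed const_in_poly_ring)
    qed (auto simp: poly_ring_closed in_keys_iff lookup_add)
  qed
qed

lemma ideal_qsym_ideal: "ideal (qsym_ideal n) (poly_ring n)"
  unfolding qsym_ideal_def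
  using cring_poly_ring nonconst_qsym_subset by (auto intro!: ring.genideal_ideal cring.axioms(1))

lemma qsym_ideal_proper: "1 \<notin> qsym_ideal n"
proof -
  interpret cring "poly_ring n" by (rule cring_poly_ring)
  let ?A = "{p \<in> carrier (poly_ring n). 0 \<notin> Poly_Mapping.keys p}"
  have mult: "q * p \<in> ?A" if "p \<in> ?A" "q \<in> carrier (poly_ring n)" for p q
  proof -
    have "0 \<notin> Poly_Mapping.keys (q * p)"
    proof
      assume "0 \<in> Poly_Mapping.keys (q * p)"
      then obtain a b where ab: "0 = a + b" "b \<in> Poly_Mapping.keys p"
        using Poly_Mapping.keys_mult[of q p] by blast
      have "Poly_Mapping.lookup b i = 0" for i
        using arg_cong[OF ab(1), of "\<lambda>m. Poly_Mapping.lookup m i"] by (simp add: lookup_add)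
      then have "b = 0"
        by (simp add: poly_mapping_eq_iff fun_eq_iff)
      then show False
        using ab that by simp
    qed
    then show ?thesis
      using that by (simp add: poly_ring_closed)
  qed
  have "ideal ?A (poly_ring n)"
  proof (rule idealI)
    show "subgroup ?A (add_monoid (poly_ring n))"
    proof (rule add.subgroupI)
      show "?A \<noteq> {}" using poly_ring_closed(1)[of n] by (auto intro!: exI[of _ 0])
    qed (auto simp: a_inv_poly_ring poly_ring_ops poly_ring_closed in_keys_iff lookup_add)
  qed (use mult ring_axioms in \<open>simp_all add: poly_ring_ops mult.commute\<close>)
  then have "qsym_ideal n \<subseteq> ?A"
    unfolding qsym_ideal_def using nonconst_qsym_subset by (rule genideal_minimal)
  then show ?thesis
    by auto
qed

lemma subfield_quotient_constants: "subfield (quotient_constants n) (qsym_quotient n)"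
proof -
  interpret J: ideal "qsym_ideal n" "poly_ring n" by (rule ideal_qsym_ideal)
  interpret h: ring_hom_ring "poly_ring n" "qsym_quotient n" "(+>\<^bsub>poly_ring n\<^esub>) (qsym_ideal n)"
    unfolding qsym_quotient_def by (rule J.rcos_ring_hom_ring)
  have "\<one>\<^bsub>qsym_quotient n\<^esub> \<noteq> \<zero>\<^bsub>qsym_quotient n\<^esub>"
    using J.a_rcos_self[of 1] qsym_ideal_proper[of n] poly_ring_closed(2)[of n]
    by (auto simp: qsym_quotient_def FactRing_def poly_ring_ops)
  then show ?thesis
    unfolding quotient_constants_def by (rule h.img_is_subfield(2)[OF subfield_constants])
qed

end

theory Submission
  imports Defs
begin

text \<open>
  Write \<open>F\<^sub>k \<alpha>\<close> for \<open>F\<^sub>\<alpha>(x\<^sub>k, \<dots>, x\<^sub>n)\<close>. Splitting off the first index gives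
  \<open>F\<^sub>k (a # b) = F\<^sub>k\<^sub>+\<^sub>1 (a # b) + x\<^sub>k F\<^sub>k ((a - 1) # b)\<close> for \<open>a \<ge> 2\<close>, and the same with
  \<open>F\<^sub>k\<^sub>+\<^sub>1 b\<close> as last factor for \<open>a = 1\<close>. Solved for \<open>F\<^sub>k\<^sub>+\<^sub>1\<close>, this recurrence is an operator
  on families of polynomials indexed by compositions (\<open>qsym_step\<close>). Reading an exponent vector
  \<open>s\<close> from left to right, and applying the operator at each entry 0 and prefixing the composition
  with each entry \<open>a > 0\<close>, turns the family \<open>F\<^sub>1\<close> into a polynomial with lexicographically
  leading monomial \<open>x\<^sup>s\<close>. The operator costs one unit of the excess of \<open>\<Sum>\<alpha>\<close> over the length of
  \<open>\<alpha>\<close>, so the polynomial lies in the ideal whenever some prefix of \<open>s\<close> of length \<open>i \<ge> 1\<close>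
  has sum at least \<open>i\<close>. The other monomials span the quotient and are counted by the Catalan number.

  All these other monomials have degree less than \<open>n\<close>, so the ideal contains every monomial of
  degree at least \<open>n\<close>. Hence every linear functional on the quotient is the scalar product with a
  polynomial, and the super-harmonic polynomials form the dual space of the quotient.
\<close>

interpretation vs: vector_space "\<lambda>c (p :: rpoly). const c * p"
  by (rule vector_space_const_mult)

section \<open>Quasi-symmetric polynomials in a final segment of the variables\<close>

text \<open>Compositions have no part 0; treating 0 like 1 makes the recursion terminate, since
  \<open>a - 1\<close> would not decrease. For \<open>k > n\<close> only the empty index sequence
  exists.\<close>

function qsym_from :: "nat \<Rightarrow> nat \<Rightarrow> nat list \<Rightarrow> rpoly" where
  "qsym_from n k [] = 1"
| "qsym_from n k (a # b) =
    (if n < k then 0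
     else qsym_from n (Suc k) (a # b)
       + var k * (if a \<le> 1 then qsym_from n (Suc k) b else qsym_from n k ((a - 1) # b)))"
  by pat_completeness auto
termination
  by (relation "measure (\<lambda>(n, k, b). (Suc n - k) + sum_list b)") auto

declare qsym_from.simps(2) [simp del]

text \<open>The index set of \<open>fundamental_qsym\<close>, with \<open>k\<close> in place of 1 as
  least index allowed.\<close>

definition qsym_words :: "nat \<Rightarrow> nat \<Rightarrow> nat list \<Rightarrow> nat list set" where
  "qsym_words n k \<alpha> = {js. length js = sum_list \<alpha> \<and> set js \<subseteq> {k..n} \<and> sorted js \<and>
               (\<forall>i\<in>partial_sums \<alpha>. js ! (i - 1) < js ! i)}"

lemma finite_qsym_words: "finite (qsym_words n k \<alpha>)"
  by (rule finite_subset[OF _ finite_lists_length_eq[of "{k..n}" "sum_list \<alpha>"]])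
    (auto simp: qsym_words_def)

lemma partial_sums_Cons:
  "partial_sums (a # b) = (if b = [] then {} else (+) a ` insert 0 (partial_sums b))"
proof (cases "b = []")
  case False
  have "{1..<length (a # b)} = Suc ` insert 0 {1..<length b}"
    using False by (auto simp: image_Suc_atLeastLessThan simp del: image_insert)
      (auto simp: image_iff less_Suc_eq_0_disj gr0_conv_Suc Suc_le_eq)
  then have "partial_sums (a # b) = (\<lambda>k. sum_list (take k (a # b))) ` Suc ` insert 0 {1..<length b}"
    by (simp only: partial_sums_def)
  also have "\<dots> = (+) a ` (\<lambda>k. sum_list (take k b)) ` insert 0 {1..<length b}"
    by (simp only: image_image take_Suc_Cons sum_list.Cons)
  finally show ?thesis
    using False by (simp add: partial_sums_def)
qed (simp add: partial_sums_def)

lemma partial_sums_pos: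
  assumes "0 \<notin> set b" "i \<in> partial_sums b"
  shows "0 < i"
  using assms by (cases b) (auto simp: partial_sums_Cons partial_sums_def[of "[]"] split: if_splits)

text \<open>A first part 1 forces an ascent right after \<open>k\<close>, and by sortedness the
  whole tail then avoids \<open>k\<close>. The remaining ascents are those required by
  \<open>b\<close>, one position later.\<close>

lemma qsym_words_Cons_eq_1:
  assumes "k \<le> n" "0 \<notin> set b"
  shows "k # js \<in> qsym_words n k (Suc 0 # b) \<longleftrightarrow> js \<in> qsym_words n (Suc k) b"
proof (cases "b = []")
  case True
  then show ?thesis using assms by (auto simp: qsym_words_def partial_sums_Cons partial_sums_def)
next
  case False
  have len: "length js = sum_list b \<Longrightarrow> js \<noteq> []"
    using False assms by (cases b; cases js) auto
  \<comment> \<open>Partial sums of positive parts are positive, so \<open>(k # js) ! i\<close> is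
    \<open>js ! (i - 1)\<close> at each of them.\<close>
  have idx: "(\<forall>i\<in>partial_sums b. (k # js) ! i < js ! i) \<longleftrightarrow>
     (\<forall>i\<in>partial_sums b. js ! (i - 1) < js ! i)"
    using partial_sums_pos[OF assms(2)] by (intro ball_cong refl) (auto simp: nth_Cons')
  have first: "set js \<subseteq> {k..n} \<and> sorted (k # js) \<and> k < js ! 0 \<longleftrightarrow> set js \<subseteq> {Suc k..n} \<and> sorted js"
    if "js \<noteq> []"
  proof -
    obtain j ks where js: "js = j # ks" using \<open>js \<noteq> []\<close> by (cases js) auto
    have "k < j \<Longrightarrow> \<forall>x\<in>set ks. j \<le> x \<Longrightarrow> \<forall>x\<in>set ks. k < x"
      by (meson less_le_trans)
    then show ?thesis
      unfolding js by (auto simp: Suc_le_eq subset_iff intro: less_imp_le)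
  qed
  show ?thesis
    using False len first assms(1) idx
    by (auto simp: qsym_words_def partial_sums_Cons)
qed

text \<open>No ascent is required after the first index here, so the tail may start with
  \<open>k\<close> again.\<close>

lemma qsym_words_Cons_gt_1:
  assumes "k \<le> n" "0 \<notin> set b" "1 < a"
  shows "k # js \<in> qsym_words n k (a # b) \<longleftrightarrow> js \<in> qsym_words n k ((a - 1) # b)"
proof -
  have idx: "(\<forall>i\<in>partial_sums (a # b). (k # js) ! (i - 1) < (k # js) ! i) \<longleftrightarrow>
     (\<forall>i\<in>partial_sums ((a - 1) # b). js ! (i - 1) < js ! i)"
    using assms(3) by (auto simp: partial_sums_Cons nth_Cons' diff_diff_eq)
  have "set js \<subseteq> {k..n} \<Longrightarrow> sorted (k # js) \<longleftrightarrow> sorted js"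
    by auto
  then show ?thesis
    using idx assms by (auto simp: qsym_words_def)
qed

text \<open>A nonempty sorted word either starts with \<open>k\<close> or avoids \<open>k\<close>
  altogether.\<close>

lemma qsym_words_eq:
  assumes "k \<le> n" "0 \<notin> set b" "0 < a"
  shows "qsym_words n k (a # b) = qsym_words n (Suc k) (a # b) \<union>
    Cons k ` (if a \<le> 1 then qsym_words n (Suc k) b else qsym_words n k ((a - 1) # b))"
    (is "_ = _ \<union> Cons k ` ?W")
proof -
  have hd: "k # js \<in> qsym_words n k (a # b) \<longleftrightarrow> js \<in> ?W" for js
    using assms qsym_words_Cons_eq_1[of k n b js] qsym_words_Cons_gt_1[of k n b a js]
    by (cases "a = 1") auto
  have tl: "j # js \<in> qsym_words n k (a # b) \<longleftrightarrow> j # js \<in> qsym_words n (Suc k) (a # b)"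
    if "j \<noteq> k" for j js
    using that by (fastforce simp: qsym_words_def)
  have "js \<in> qsym_words n k (a # b) \<longleftrightarrow> js \<in> qsym_words n (Suc k) (a # b) \<union> Cons k ` ?W" for js
  proof (cases js)
    case Nil
    then show ?thesis using assms(3) by (auto simp: qsym_words_def)
  next
    case (Cons j ks)
    have "k # ks \<notin> qsym_words n (Suc k) (a # b)"
      by (auto simp: qsym_words_def)
    then show ?thesis
      using hd[of ks] tl[of j ks] Cons by (cases "j = k") auto
  qed
  then show ?thesis by blast
qed

lemma qsym_from_eq_sum:
  assumes "0 \<notin> set \<alpha>"
  shows "qsym_from n k \<alpha> = (\<Sum>js\<in>qsym_words n k \<alpha>. \<Prod>j\<leftarrow>js. var j)"
  using assms
proof (induction n k \<alpha> rule: qsym_from.induct)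
  case (1 n k)
  have "qsym_words n k [] = {[]}"
    by (auto simp: qsym_words_def partial_sums_def)
  then show ?case by simp
next
  case (2 n k a b)
  show ?case
  proof (cases "n < k")
    case True
    have "qsym_words n k (a # b) = {}"
      using True 2(4) by (auto simp: qsym_words_def)
    then show ?thesis using True by (simp add: qsym_from.simps)
  next
    case False
    let ?W = "if a \<le> 1 then qsym_words n (Suc k) b else qsym_words n k ((a - 1) # b)"
    have fin: "finite ?W" by (simp add: finite_qsym_words)
    have "qsym_words n (Suc k) (a # b) \<inter> Cons k ` ?W = {}"
      by (auto simp: qsym_words_def)
    then have "(\<Sum>js\<in>qsym_words n k (a # b). \<Prod>j\<leftarrow>js. var j)
        = (\<Sum>js\<in>qsym_words n (Suc k) (a # b). \<Prod>j\<leftarrow>js. var j)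
          + (\<Sum>js\<in>Cons k ` ?W. \<Prod>j\<leftarrow>js. var j)"
      using False 2(4) qsym_words_eq[of k n b a]
      by (simp add: sum.union_disjoint finite_qsym_words)
    also have "(\<Sum>js\<in>Cons k ` ?W. \<Prod>j\<leftarrow>js. var j) = var k * (\<Sum>js\<in>?W. \<Prod>j\<leftarrow>js. var j)"
      by (subst sum.reindex) (auto simp: sum_distrib_left)
    also have "(\<Sum>js\<in>?W. \<Prod>j\<leftarrow>js. var j) =
       (if a \<le> 1 then qsym_from n (Suc k) b else qsym_from n k ((a - 1) # b))"
      using 2 False by (auto simp: set_ConsD)
    finally show ?thesis
      using False 2 by (simp add: qsym_from.simps(2)[of n k a b])
  qed
qed

lemma qsym_from_1_eq:
  assumes "0 \<notin> set \<alpha>"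
  shows "qsym_from n 1 \<alpha> = fundamental_qsym n \<alpha>"
  using qsym_from_eq_sum[OF assms] by (simp add: fundamental_qsym_def qsym_words_def)

section \<open>Straightening\<close>

text \<open>At \<open>a = 1\<close> the factor of \<open>x\<^sub>k\<close> in the recurrence already
  belongs to the new family, which is why this case recurses while the other one uses
  \<Phi>.\<close>

fun qsym_step :: "nat \<Rightarrow> (nat list \<Rightarrow> rpoly) \<Rightarrow> nat list \<Rightarrow> rpoly" where
  "qsym_step k \<Phi> [] = \<Phi> []"
| "qsym_step k \<Phi> (a # b) =
    \<Phi> (a # b) - var k * (if a \<le> 1 then qsym_step k \<Phi> b else \<Phi> ((a - 1) # b))"

lemma qsym_step_qsym_from:
  assumes "k \<le> n"
  shows "qsym_step k (qsym_from n k) = qsym_from n (Suc k)"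
proof
  fix b show "qsym_step k (qsym_from n k) b = qsym_from n (Suc k) b"
  proof (induction b)
    case (Cons a b)
    then show ?case using assms by (simp add: qsym_from.simps(2)[of n k a b])
  qed simp
qed

fun straighten :: "nat \<Rightarrow> nat list \<Rightarrow> (nat list \<Rightarrow> rpoly) \<Rightarrow> rpoly" where
  "straighten k [] \<Phi> = \<Phi> []"
| "straighten k (a # s) \<Phi> =
    straighten (Suc k) s (if a = 0 then qsym_step k \<Phi> else (\<lambda>b. \<Phi> (a # b)))"

text \<open>The operator is linear over the polynomial ring, and so is straightening. This allows an
  expansion of the family in powers of one variable to be straightened term by term.\<close>

lemma qsym_step_add:
  "qsym_step k (\<lambda>b. \<Phi> b + \<Psi> b) = (\<lambda>b. qsym_step k \<Phi> b + qsym_step k \<Psi> b)"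
proof
  fix b show "qsym_step k (\<lambda>b. \<Phi> b + \<Psi> b) b = qsym_step k \<Phi> b + qsym_step k \<Psi> b"
    by (induction b) (simp_all add: algebra_simps)
qed

lemma qsym_step_mult:
  "qsym_step k (\<lambda>b. p * \<Phi> b) = (\<lambda>b. p * qsym_step k \<Phi> b)"
proof
  fix b show "qsym_step k (\<lambda>b. p * \<Phi> b) b = p * qsym_step k \<Phi> b"
    by (induction b) (simp_all add: algebra_simps)
qed

lemma straighten_add:
  "straighten k s (\<lambda>b. \<Phi> b + \<Psi> b) = straighten k s \<Phi> + straighten k s \<Psi>"
proof (induction s arbitrary: k \<Phi> \<Psi>)
  case (Cons a s)
  then show ?case by (cases "a = 0") (simp_all add: qsym_step_add)
qed simp

lemma straighten_mult:
  "straighten k s (\<lambda>b. p * \<Phi> b) = p * straighten k s \<Phi>"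
proof (induction s arbitrary: k \<Phi>)
  case (Cons a s)
  then show ?case by (cases "a = 0") (simp_all add: qsym_step_mult)
qed simp

lemma straighten_0: "straighten k s (\<lambda>_. 0) = 0"
  using straighten_mult[of k s 0 "\<lambda>_. 0"] by simp

lemma straighten_sum:
  "straighten k s (\<lambda>b. \<Sum>i\<in>I. \<Phi> i b) = (\<Sum>i\<in>I. straighten k s (\<Phi> i))"
  by (induction I rule: infinite_finite_induct) (simp_all add: straighten_0 straighten_add)

section \<open>Exponent vectors as lists, and homogeneity\<close>

fun monom_of :: "nat \<Rightarrow> nat list \<Rightarrow> nat \<Rightarrow>\<^sub>0 nat" where
  "monom_of k [] = 0"
| "monom_of k (a # s) = Poly_Mapping.single k a + monom_of (Suc k) s"

lemma single_add_monom_of: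
  assumes "i < length t"
  shows "Poly_Mapping.single (k + i) 1 + monom_of k t = monom_of k (t[i := Suc (t ! i)])"
  using assms
proof (induction t arbitrary: k i)
  case (Cons a t)
  have "Poly_Mapping.single k (Suc a) = Poly_Mapping.single k 1 + Poly_Mapping.single k a"
    by (simp flip: single_add)
  with Cons.prems Cons.IH[of "i - 1" "Suc k"] show ?case
    by (cases i) (auto simp: ac_simps)
qed simp

lemma keys_single_mult:
  "Poly_Mapping.keys (Poly_Mapping.single u (c::rat) * p) \<subseteq> (+) u ` Poly_Mapping.keys p"
  using keys_mult[of "Poly_Mapping.single u c" p] by (auto split: if_splits)

lemma var_power: "var k ^ a = Poly_Mapping.single (Poly_Mapping.single k a) 1"
proof (induction a)
  case (Suc a)
  have "Poly_Mapping.single k (Suc a) = Poly_Mapping.single k 1 + Poly_Mapping.single k a"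
    by (simp flip: single_add)
  then show ?case
    using Suc by (simp add: var_def mult_single)
qed simp

text \<open>The monomials of degree \<open>d\<close> in
  \<open>x\<^sub>k, \<dots>, x\<^sub>n\<close>.\<close>

definition homog_monoms :: "nat \<Rightarrow> nat \<Rightarrow> nat \<Rightarrow> (nat \<Rightarrow>\<^sub>0 nat) set" where
  "homog_monoms n k d = {monom_of k t | t. length t = Suc n - k \<and> sum_list t = d}"

lemma keys_plus_subset:
  fixes p q :: rpoly
  shows "Poly_Mapping.keys p \<subseteq> S \<Longrightarrow> Poly_Mapping.keys q \<subseteq> S \<Longrightarrow> Poly_Mapping.keys (p + q) \<subseteq> S"
  using Poly_Mapping.keys_add[of p q] by blast

lemma keys_minus_subset:
  fixes p q :: rpoly
  shows "Poly_Mapping.keys p \<subseteq> S \<Longrightarrow> Poly_Mapping.keys q \<subseteq> S \<Longrightarrow> Poly_Mapping.keys (p - q) \<subseteq> S"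
  using keys_plus_subset[of p S "- q"] by simp

lemma homog_var_mult:
  assumes "Poly_Mapping.keys p \<subseteq> homog_monoms n k d" "k \<le> j" "j \<le> n"
  shows "Poly_Mapping.keys (var j * p) \<subseteq> homog_monoms n k (Suc d)"
proof -
  have "Poly_Mapping.single j 1 + m \<in> homog_monoms n k (Suc d)" if m: "m \<in> homog_monoms n k d" for m
  proof -
    obtain t where t: "m = monom_of k t" "length t = Suc n - k" "sum_list t = d"
      using m by (auto simp: homog_monoms_def)
    then have "Poly_Mapping.single j 1 + m = monom_of k (t[j - k := Suc (t ! (j - k))])"
      using assms single_add_monom_of[of "j - k" t k] by simp
    moreover have "sum_list (t[j - k := Suc (t ! (j - k))]) = Suc d"
      using t assms elem_le_sum_list[of "j - k" t] by (simp add: sum_list_update)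
    ultimately show ?thesis
      using t unfolding homog_monoms_def by (metis (mono_tags, lifting) length_list_update mem_Collect_eq)
  qed
  then show ?thesis
    using keys_single_mult[of "Poly_Mapping.single j 1" 1 p] assms(1) by (auto simp: var_def)
qed

lemma homog_1: "Poly_Mapping.keys (1 :: rpoly) \<subseteq> homog_monoms n k 0"
proof -
  have "monom_of k (replicate m 0) = 0" for m k
    by (induction m arbitrary: k) auto
  then have "0 \<in> homog_monoms n k 0"
    unfolding homog_monoms_def
    by (auto intro!: exI[of _ "replicate (Suc n - k) 0"] simp: sum_list_replicate)
  then show ?thesis by simp
qed

text \<open>The bound \<open>k'\<close> names the ambient variables and stays fixed while the
  recursion raises \<open>k\<close>.\<close>

lemma homog_qsym_from:
  assumes "0 \<notin> set \<alpha>" "k' \<le> k"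
  shows "Poly_Mapping.keys (qsym_from n k \<alpha>) \<subseteq> homog_monoms n k' (sum_list \<alpha>)"
  using assms
proof (induction n k \<alpha> rule: qsym_from.induct)
  case (1 n k)
  then show ?case using homog_1 by simp
next
  case (2 n k a b)
  show ?case
  proof (cases "n < k")
    case False
    have eq: "sum_list (a # b) = Suc (sum_list (if a \<le> 1 then b else (a - 1) # b))"
      using 2(4) by auto
    have "Poly_Mapping.keys (qsym_from n (Suc k) (a # b)) \<subseteq> homog_monoms n k' (sum_list (a # b))"
      using 2 False by simp
    moreover have "Poly_Mapping.keys (if a \<le> 1 then qsym_from n (Suc k) b else qsym_from n k ((a - 1) # b))
       \<subseteq> homog_monoms n k' (sum_list (if a \<le> 1 then b else (a - 1) # b))"
      using 2 False by simp
    then have "Poly_Mapping.keys (var k *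
        (if a \<le> 1 then qsym_from n (Suc k) b else qsym_from n k ((a - 1) # b)))
       \<subseteq> homog_monoms n k' (sum_list (a # b))"
      unfolding eq using 2(5) False by (intro homog_var_mult) auto
    ultimately show ?thesis
      unfolding qsym_from.simps(2)[of n k a b] if_not_P[OF False] by (rule keys_plus_subset)
  qed (simp add: qsym_from.simps)
qed

lemma homog_qsym_step:
  assumes "\<And>b. 0 \<notin> set b \<Longrightarrow> Poly_Mapping.keys (\<Phi> b) \<subseteq> homog_monoms n k (c + sum_list b)"
    and "k \<le> j" "j \<le> n" "0 \<notin> set b"
  shows "Poly_Mapping.keys (qsym_step j \<Phi> b) \<subseteq> homog_monoms n k (c + sum_list b)"
  using assms(4)
proof (induction b)
  case Nil
  then show ?case using assms(1)[of "[]"] by simp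
next
  case (Cons a b)
  have eq: "c + sum_list (a # b) = Suc (c + sum_list (if a \<le> 1 then b else (a - 1) # b))"
    using Cons.prems by auto
  have "Poly_Mapping.keys (if a \<le> 1 then qsym_step j \<Phi> b else \<Phi> ((a - 1) # b))
     \<subseteq> homog_monoms n k (c + sum_list (if a \<le> 1 then b else (a - 1) # b))"
    using Cons assms(1)[of "(a - 1) # b"] by auto
  then have "Poly_Mapping.keys (var j * (if a \<le> 1 then qsym_step j \<Phi> b else \<Phi> ((a - 1) # b)))
     \<subseteq> homog_monoms n k (c + sum_list (a # b))"
    unfolding eq using assms(2,3) by (intro homog_var_mult)
  with assms(1)[OF Cons.prems] show ?case
    unfolding qsym_step.simps by (rule keys_minus_subset)
qed

text \<open>Here \<open>c\<close> is the degree contributed by entries already prefixed: an entry 0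
  leaves it alone, an entry \<open>a > 0\<close> adds \<open>a\<close> to it.\<close>

lemma homog_straighten:
  assumes "\<And>b. 0 \<notin> set b \<Longrightarrow> Poly_Mapping.keys (\<Phi> b) \<subseteq> homog_monoms n k (c + sum_list b)"
    and "k \<le> j" "j + length s \<le> Suc n"
  shows "Poly_Mapping.keys (straighten j s \<Phi>) \<subseteq> homog_monoms n k (c + sum_list s)"
  using assms
proof (induction s arbitrary: c j \<Phi>)
  case Nil
  show ?case using Nil(1)[of "[]"] by simp
next
  case (Cons a s)
  show ?case
  proof (cases "a = 0")
    case True
    have "Poly_Mapping.keys (straighten (Suc j) s (qsym_step j \<Phi>)) \<subseteq> homog_monoms n k (c + sum_list s)"
    proof (rule Cons.IH)
      show "Poly_Mapping.keys (qsym_step j \<Phi> b) \<subseteq> homog_monoms n k (c + sum_list b)"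
        if "0 \<notin> set b" for b
        using that Cons.prems by (intro homog_qsym_step) auto
    qed (use Cons.prems in auto)
    then show ?thesis using True by simp
  next
    case False
    have "Poly_Mapping.keys (straighten (Suc j) s (\<lambda>b. \<Phi> (a # b)))
        \<subseteq> homog_monoms n k (c + a + sum_list s)"
    proof (rule Cons.IH)
      show "Poly_Mapping.keys (\<Phi> (a # b)) \<subseteq> homog_monoms n k (c + a + sum_list b)"
        if "0 \<notin> set b" for b
        using that False Cons.prems(1)[of "a # b"] by (simp add: add.assoc)
    qed (use Cons.prems in auto)
    then show ?thesis using False by (simp add: add.assoc)
  qed
qed

section \<open>Leading monomials\<close>

text \<open>Iterating the recurrence sorts the terms by the number \<open>i\<close> of indices equal
  to \<open>k\<close>. If they fill the whole first part, \<open>b\<close> must start above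
  \<open>k\<close>; otherwise a part \<open>a - i\<close> is left over.\<close>

lemma qsym_from_expand:
  assumes "k \<le> n" "0 < a"
  shows "qsym_from n k (a # b) = var k ^ a * qsym_from n (Suc k) b
    + (\<Sum>i<a. var k ^ i * qsym_from n (Suc k) ((a - i) # b))"
  using assms(2)
proof (induction a rule: nat_induct_non_zero)
  case 1
  then show ?case using assms by (simp add: qsym_from.simps(2)[of n k "Suc 0"])
next
  case (Suc a)
  have "qsym_from n k (Suc a # b) = qsym_from n (Suc k) (Suc a # b) + var k * qsym_from n k (a # b)"
    using assms Suc by (simp add: qsym_from.simps(2)[of n k "Suc a" b])
  also have "(\<Sum>i<Suc a. var k ^ i * qsym_from n (Suc k) ((Suc a - i) # b)) =
     qsym_from n (Suc k) (Suc a # b) + var k * (\<Sum>i<a. var k ^ i * qsym_from n (Suc k) ((a - i) # b))"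
    by (simp add: sum.lessThan_Suc_shift sum_distrib_left mult.assoc del: sum.lessThan_Suc)
  ultimately show ?case
    using Suc by (simp add: algebra_simps)
qed

text \<open>\<open>lex\<close> compares lists of equal length from the left, so this is the
  lexicographic order on exponent vectors with \<open>x\<^sub>k\<close> the largest
  variable.\<close>

definition lower_monoms :: "nat \<Rightarrow> nat list \<Rightarrow> (nat \<Rightarrow>\<^sub>0 nat) set" where
  "lower_monoms k s = {monom_of k t | t. (t, s) \<in> lex less_than \<and> sum_list t = sum_list s}"

text \<open>An entry 0 replaces \<open>F\<^sub>k\<close> by
  \<open>F\<^sub>k\<^sub>+\<^sub>1\<close>, which is free of \<open>x\<^sub>k\<close>. At an entry
  \<open>a > 0\<close> the expansion has top power \<open>x\<^sub>k ^ a\<close> with factor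
  \<open>F\<^sub>k\<^sub>+\<^sub>1 b\<close>, where the induction hypothesis applies; all other
  terms have a smaller power of \<open>x\<^sub>k\<close>.\<close>

lemma straighten_leading_monom:
  assumes "length s = Suc n - k"
  shows "Poly_Mapping.keys (straighten k s (qsym_from n k) - Poly_Mapping.single (monom_of k s) 1)
    \<subseteq> lower_monoms k s"
  using assms
proof (induction s arbitrary: k)
  case Nil
  then show ?case by simp
next
  case (Cons a s)
  then have k: "k \<le> n" "length s = Suc n - Suc k" by auto
  let ?R = "straighten (Suc k) s (qsym_from n (Suc k)) - Poly_Mapping.single (monom_of (Suc k) s) 1"
  have IH: "Poly_Mapping.keys ?R \<subseteq> lower_monoms (Suc k) s"
    using Cons.IH k by blast
  have lower: "(+) (Poly_Mapping.single k a) ` lower_monoms (Suc k) s \<subseteq> lower_monoms k (a # s)"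
  proof (rule image_subsetI)
    fix m assume "m \<in> lower_monoms (Suc k) s"
    then obtain t where t: "m = monom_of (Suc k) t" "(t, s) \<in> lex less_than" "sum_list t = sum_list s"
      by (auto simp: lower_monoms_def)
    then show "Poly_Mapping.single k a + m \<in> lower_monoms k (a # s)"
      unfolding lower_monoms_def by (auto intro!: exI[of _ "a # t"])
  qed
  show ?case
  proof (cases "a = 0")
    case True
    have "lower_monoms (Suc k) s \<subseteq> lower_monoms k (a # s)"
      using lower True by simp
    then show ?thesis
      using True IH k by (simp add: qsym_step_qsym_from)
  next
    case False
    let ?T = "\<lambda>i. straighten (Suc k) s (\<lambda>b. qsym_from n (Suc k) ((a - i) # b))"
    have "straighten k (a # s) (qsym_from n k) - Poly_Mapping.single (monom_of k (a # s)) 1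
      = var k ^ a * ?R + (\<Sum>i<a. var k ^ i * ?T i)"
      using False k
      by (simp add: qsym_from_expand straighten_add straighten_sum straighten_mult
          right_diff_distrib var_power mult_single)
    moreover have "Poly_Mapping.keys (var k ^ a * ?R) \<subseteq> lower_monoms k (a # s)"
      using keys_single_mult[of "Poly_Mapping.single k a" 1 ?R] IH lower unfolding var_power by blast
    moreover have "Poly_Mapping.keys (var k ^ i * ?T i) \<subseteq> lower_monoms k (a # s)" if i: "i < a" for i
    proof -
      have "Poly_Mapping.keys (?T i) \<subseteq> homog_monoms n (Suc k) ((a - i) + sum_list s)"
      proof (rule homog_straighten)
        show "Poly_Mapping.keys (qsym_from n (Suc k) ((a - i) # b))
           \<subseteq> homog_monoms n (Suc k) ((a - i) + sum_list b)" if "0 \<notin> set b" for b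
          using homog_qsym_from[of "(a - i) # b" "Suc k" "Suc k" n] i that by simp
      qed (use k in auto)
      \<comment> \<open>A first entry \<open>i < a\<close> makes the list smaller whatever follows;
        homogeneity supplies the correct total degree.\<close>
      moreover have "(+) (Poly_Mapping.single k i) ` homog_monoms n (Suc k) ((a - i) + sum_list s)
         \<subseteq> lower_monoms k (a # s)"
      proof (rule image_subsetI)
        fix m assume "m \<in> homog_monoms n (Suc k) ((a - i) + sum_list s)"
        then obtain t where t: "m = monom_of (Suc k) t" "length t = length s"
            "sum_list t = (a - i) + sum_list s"
          using k by (auto simp: homog_monoms_def)
        then show "Poly_Mapping.single k i + m \<in> lower_monoms k (a # s)"
          using i unfolding lower_monoms_def by (auto intro!: exI[of _ "i # t"])
      qed
      ultimately show ?thesis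
        using keys_single_mult[of "Poly_Mapping.single k i" 1 "?T i"] unfolding var_power by blast
    qed
    then have "Poly_Mapping.keys (\<Sum>i<a. var k ^ i * ?T i) \<subseteq> lower_monoms k (a # s)"
      using Poly_Mapping.keys_sum[of "\<lambda>i. var k ^ i * ?T i" "{..<a}"] by blast
    ultimately show ?thesis
      by (simp only: keys_plus_subset)
  qed
qed

section \<open>Straightened elements of the ideal\<close>

lemma qsym_ideal_closed:
  shows "0 \<in> qsym_ideal n"
    and "p \<in> qsym_ideal n \<Longrightarrow> q \<in> qsym_ideal n \<Longrightarrow> p + q \<in> qsym_ideal n"
    and "p \<in> qsym_ideal n \<Longrightarrow> q \<in> qsym_ideal n \<Longrightarrow> p - q \<in> qsym_ideal n"
    and "p \<in> qsym_ideal n \<Longrightarrow> q \<in> carrier (poly_ring n) \<Longrightarrow> q * p \<in> qsym_ideal n"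
    and "qsym_ideal n \<subseteq> carrier (poly_ring n)"
proof -
  interpret J: ideal "qsym_ideal n" "poly_ring n" by (rule ideal_qsym_ideal)
  show "0 \<in> qsym_ideal n"
    using additive_subgroup.zero_closed[OF J.is_additive_subgroup] by (simp add: poly_ring_ops)
  show add: "p \<in> qsym_ideal n \<Longrightarrow> q \<in> qsym_ideal n \<Longrightarrow> p + q \<in> qsym_ideal n" for p q
    using additive_subgroup.a_closed[OF J.is_additive_subgroup, of p q] by (simp add: poly_ring_ops)
  show mult: "p \<in> qsym_ideal n \<Longrightarrow> q \<in> carrier (poly_ring n) \<Longrightarrow> q * p \<in> qsym_ideal n" for p q
    using J.I_l_closed[of p q] by (simp add: poly_ring_ops)
  show "p \<in> qsym_ideal n \<Longrightarrow> q \<in> qsym_ideal n \<Longrightarrow> p - q \<in> qsym_ideal n"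
    using add[of p "- q"] mult[of q "- 1"] poly_ring_closed(3)[OF poly_ring_closed(2), of n] by simp
  show "qsym_ideal n \<subseteq> carrier (poly_ring n)"
    using J.Icarr by blast
qed

lemma subspace_qsym_ideal: "vs.subspace (qsym_ideal n)"
  by (rule vs.subspaceI) (simp_all add: qsym_ideal_closed const_in_poly_ring)

lemma var_in_poly_ring: "1 \<le> k \<Longrightarrow> k \<le> n \<Longrightarrow> var k \<in> carrier (poly_ring n)"
  by (simp add: var_def mem_poly_ring)

lemma qsym_from_in_ideal:
  assumes "0 \<notin> set b" "b \<noteq> []"
  shows "qsym_from n 1 b \<in> qsym_ideal n"
proof -
  interpret cring "poly_ring n" by (rule cring_poly_ring)
  have "0 < sum_list b"
    using assms by (cases b) auto
  moreover have "composition (sum_list b) b"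
    using assms(1) by (auto simp: composition_def intro: gr0I)
  ultimately have "fundamental_qsym n b \<in> nonconst_qsym n"
    unfolding nonconst_qsym_def by (intro vs.span_base) blast
  then show ?thesis
    using genideal_self[of "nonconst_qsym n"] nonconst_qsym_subset[of n] qsym_from_1_eq[OF assms(1)]
    unfolding qsym_ideal_def by auto
qed

lemma qsym_step_in_ideal:
  assumes "\<And>b. 0 \<notin> set b \<Longrightarrow> \<Phi> b \<in> qsym_ideal n"
    and "1 \<le> j" "j \<le> n" "0 \<notin> set b"
  shows "qsym_step j \<Phi> b \<in> qsym_ideal n"
  using assms(4)
proof (induction b)
  case (Cons a b)
  have "(if a \<le> 1 then qsym_step j \<Phi> b else \<Phi> ((a - 1) # b)) \<in> qsym_ideal n"
    using Cons assms(1)[of "(a - 1) # b"] by auto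
  then show ?case
    using assms(1)[OF Cons.prems] assms(2,3)
    unfolding qsym_step.simps by (intro qsym_ideal_closed var_in_poly_ring)
qed (use assms(1) in simp)

text \<open>Once the whole family lies in the ideal, its value at the empty composition included,
  the remaining entries are irrelevant.\<close>

lemma straighten_in_ideal:
  assumes "\<And>b. 0 \<notin> set b \<Longrightarrow> \<Phi> b \<in> qsym_ideal n" "1 \<le> j" "j + length s \<le> Suc n"
  shows "straighten j s \<Phi> \<in> qsym_ideal n"
  using assms
proof (induction s arbitrary: j \<Phi>)
  case (Cons a s)
  then show ?case
    using qsym_step_in_ideal[of \<Phi> n j] by (cases "a = 0") auto
qed simp

text \<open>
  For \<open>c = 0\<close> the condition says that the first \<open>i\<close> entries have sum less than \<open>i\<close>, for every
  \<open>i \<ge> 1\<close>; such lists encode Dyck paths.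
\<close>

fun ballot :: "nat \<Rightarrow> nat list \<Rightarrow> bool" where
  "ballot c [] \<longleftrightarrow> True"
| "ballot c (a # s) \<longleftrightarrow> a \<le> c \<and> ballot (Suc c - a) s"

text \<open>Lowering a part \<open>a > 1\<close> costs one unit of excess of sum over length, and
  then \<Phi> applies. Dropping a part 1 costs nothing, so the recursion keeps excess
  \<open>Suc c\<close>, which also keeps the rest of the composition nonempty.\<close>

lemma qsym_step_excess_in_ideal:
  assumes "\<And>b. 0 \<notin> set b \<Longrightarrow> b \<noteq> [] \<Longrightarrow> length b + c \<le> sum_list b \<Longrightarrow> \<Phi> b \<in> qsym_ideal n"
    and "1 \<le> j" "j \<le> n" "0 \<notin> set b" "b \<noteq> []" "length b + Suc c \<le> sum_list b"
  shows "qsym_step j \<Phi> b \<in> qsym_ideal n"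
  using assms(4-6)
proof (induction b)
  case (Cons a b)
  have "(if a \<le> 1 then qsym_step j \<Phi> b else \<Phi> ((a - 1) # b)) \<in> qsym_ideal n"
  proof (cases "a \<le> 1")
    case True
    then have "length b + Suc c \<le> sum_list b"
      using Cons.prems by auto
    moreover from this have "b \<noteq> []" by auto
    ultimately show ?thesis
      using True Cons by simp
  next
    case False
    then show ?thesis
      using Cons.prems assms(1)[of "(a - 1) # b"] by auto
  qed
  then show ?case
    using assms(1)[of "a # b"] assms(2,3) Cons.prems
    unfolding qsym_step.simps by (intro qsym_ideal_closed var_in_poly_ring) auto
qed simp

lemma length_le_sum_list: "0 \<notin> set b \<Longrightarrow> length b \<le> sum_list b" for b :: "nat list"
  by (induction b) auto

text \<open>Invariant: the family lies in the ideal at nonempty compositions of excess at least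
  \<open>c\<close>. An entry 0 raises \<open>c\<close> by one, and prefixing \<open>a > 0\<close>
  adds \<open>a - 1\<close> to the excess. Failure of \<open>ballot\<close> means that some entry
  exceeds the current \<open>c\<close>; from there on even \<open>[a]\<close> has enough
  excess.\<close>

lemma straighten_excess_in_ideal:
  assumes "\<And>b. 0 \<notin> set b \<Longrightarrow> b \<noteq> [] \<Longrightarrow> length b + c \<le> sum_list b \<Longrightarrow> \<Phi> b \<in> qsym_ideal n"
    and "1 \<le> j" "j + length s \<le> Suc n" "\<not> ballot c s"
  shows "straighten j s \<Phi> \<in> qsym_ideal n"
  using assms
proof (induction s arbitrary: c j \<Phi>)
  case (Cons a s)
  consider "a = 0" | "a > c" | "0 < a" "a \<le> c" by linarith
  then show ?case
  proof cases
    case 1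
    have "straighten (Suc j) s (qsym_step j \<Phi>) \<in> qsym_ideal n"
    proof (rule Cons.IH[of "Suc c"])
      show "qsym_step j \<Phi> b \<in> qsym_ideal n"
        if "0 \<notin> set b" "b \<noteq> []" "length b + Suc c \<le> sum_list b" for b
        using that Cons.prems by (intro qsym_step_excess_in_ideal[of c]) auto
    qed (use 1 Cons.prems in auto)
    then show ?thesis using 1 by simp
  next
    case 2
    have "straighten (Suc j) s (\<lambda>b. \<Phi> (a # b)) \<in> qsym_ideal n"
    proof (rule straighten_in_ideal)
      show "\<Phi> (a # b) \<in> qsym_ideal n" if "0 \<notin> set b" for b
        using that 2 length_le_sum_list[of b] by (intro Cons.prems(1)) auto
    qed (use Cons.prems in auto)
    then show ?thesis using 2 by simp
  next
    case 3
    have "straighten (Suc j) s (\<lambda>b. \<Phi> (a # b)) \<in> qsym_ideal n"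
    proof (rule Cons.IH[of "Suc c - a"])
      show "\<Phi> (a # b) \<in> qsym_ideal n"
        if "0 \<notin> set b" "b \<noteq> []" "length b + (Suc c - a) \<le> sum_list b" for b
        using that 3 by (intro Cons.prems(1)) auto
    qed (use 3 Cons.prems in auto)
    then show ?thesis using 3 by simp
  qed
qed simp

section \<open>Ballot monomials span the quotient\<close>

definition monomial :: "(nat \<Rightarrow>\<^sub>0 nat) \<Rightarrow> rpoly" where
  "monomial m = Poly_Mapping.single m 1"

definition ballot_lists :: "nat \<Rightarrow> nat \<Rightarrow> nat list set" where
  "ballot_lists m c = {s. length s = m \<and> ballot c s}"

lemma poly_eq_sum_monomials:
  "p = (\<Sum>m\<in>Poly_Mapping.keys p. const (Poly_Mapping.lookup p m) * monomial m)"
proof (rule poly_mapping_eqI)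
  fix k
  show "Poly_Mapping.lookup p k = Poly_Mapping.lookup
     (\<Sum>m\<in>Poly_Mapping.keys p. const (Poly_Mapping.lookup p m) * monomial m) k"
    by (simp add: lookup_sum const_def monomial_def mult_single lookup_single when_def
        in_keys_iff)
qed

lemma in_span_if_keys:
  assumes "\<And>m. m \<in> Poly_Mapping.keys p \<Longrightarrow> monomial m \<in> vs.span S"
  shows "p \<in> vs.span S"
  by (subst poly_eq_sum_monomials) (intro vs.span_sum vs.span_scale assms)

lemma lookup_monom_of:
  "Poly_Mapping.lookup (monom_of k t) i = (if k \<le> i \<and> i < k + length t then t ! (i - k) else 0)"
proof (induction t arbitrary: k)
  case (Cons a t)
  then show ?case
    by (auto simp: lookup_add lookup_single when_def nth_Cons' not_less_eq_eq)
qed simp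

lemma monom_of_lookup:
  assumes "Poly_Mapping.keys m \<subseteq> {k..n}"
  shows "monom_of k (map (Poly_Mapping.lookup m) [k..<Suc n]) = m"
proof (rule poly_mapping_eqI)
  fix i
  have "i \<notin> {k..n} \<Longrightarrow> Poly_Mapping.lookup m i = 0"
    using assms by (auto simp: in_keys_iff)
  then show "Poly_Mapping.lookup (monom_of k (map (Poly_Mapping.lookup m) [k..<Suc n])) i
    = Poly_Mapping.lookup m i"
    by (auto simp: lookup_monom_of simp del: upt_Suc)
qed

text \<open>For a list that is not ballot, the ideal element with leading monomial
  \<open>x\<^sup>s\<close> trades this monomial for smaller ones of the same degree. Recording the
  degree is what later shows that high-degree monomials lie in the ideal.\<close>

lemma monomial_in_span_ballot:
  assumes "length s = n"
  shows "monomial (monom_of 1 s) \<in>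
    vs.span ((\<lambda>t. monomial (monom_of 1 t)) ` {t \<in> ballot_lists n 0. sum_list t = sum_list s}
      \<union> qsym_ideal n)"
proof -
  \<comment> \<open>Well-foundedness relies on \<open>lex\<close> relating only lists of equal
    length.\<close>
  have "wf (lex less_than)" by (simp add: wf_lex)
  then show ?thesis using assms
  proof (induction s rule: wf_induct_rule)
    case (less s)
    let ?S = "(\<lambda>t. monomial (monom_of 1 t)) ` {t \<in> ballot_lists n 0. sum_list t = sum_list s}
      \<union> qsym_ideal n"
    show ?case
    proof (cases "ballot 0 s")
      case True
      then show ?thesis
        using less.prems by (intro vs.span_base) (auto simp: ballot_lists_def)
    next
      case False
      let ?G = "straighten 1 s (qsym_from n 1)"
      have "?G \<in> qsym_ideal n"
        using False less.prems qsym_from_in_ideal by (intro straighten_excess_in_ideal[of 0]) auto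
      then have "?G \<in> vs.span ?S"
        by (intro vs.span_base) blast
      moreover have "?G - monomial (monom_of 1 s) \<in> vs.span ?S"
      proof (rule in_span_if_keys)
        fix m assume "m \<in> Poly_Mapping.keys (?G - monomial (monom_of 1 s))"
        then obtain t where t: "m = monom_of 1 t" "(t, s) \<in> lex less_than" "sum_list t = sum_list s"
          using straighten_leading_monom[of s n 1] less.prems
          by (auto simp: lower_monoms_def monomial_def)
        moreover from t(2) have "length t = length s"
          by (simp add: lex_conv)
        ultimately show "monomial m \<in> vs.span ?S"
          using less.IH[of t] less.prems by simp
      qed
      ultimately have "?G - (?G - monomial (monom_of 1 s)) \<in> vs.span ?S"
        by (rule vs.span_diff)
      then show ?thesis by simp
    qed
  qed
qed

lemma sum_list_ballot: "ballot c s \<Longrightarrow> s \<noteq> [] \<Longrightarrow> sum_list s < c + length s"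
proof (induction s arbitrary: c)
  case (Cons a s)
  then show ?case using Cons.IH[of "Suc c - a"] by (cases "s = []") auto
qed simp

text \<open>Nonempty ballot lists of length \<open>n\<close> have sum below \<open>n\<close>, so no
  ballot monomial of this degree is left to span with.\<close>

lemma high_monomial_in_ideal:
  assumes "length s = n" "1 \<le> n" "n \<le> sum_list s"
  shows "monomial (monom_of 1 s) \<in> qsym_ideal n"
proof -
  have "{t \<in> ballot_lists n 0. sum_list t = sum_list s} = {}"
    using assms sum_list_ballot[of 0] by (fastforce simp: ballot_lists_def)
  moreover have "vs.span (qsym_ideal n) = qsym_ideal n"
    by (simp add: vs.span_eq_iff subspace_qsym_ideal)
  ultimately show ?thesis
    using monomial_in_span_ballot[OF assms(1)] by (simp only: image_empty Un_empty_left)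
qed

lemma poly_ring_subset_span:
  "carrier (poly_ring n)
    \<subseteq> vs.span ((\<lambda>t. monomial (monom_of 1 t)) ` ballot_lists n 0 \<union> qsym_ideal n)" (is "_ \<subseteq> vs.span ?S")
proof
  fix p assume p: "p \<in> carrier (poly_ring n)"
  show "p \<in> vs.span ?S"
  proof (rule in_span_if_keys)
    fix m assume "m \<in> Poly_Mapping.keys p"
    then have "monom_of 1 (map (Poly_Mapping.lookup m) [1..<Suc n]) = m"
      using p by (intro monom_of_lookup) (simp add: mem_poly_ring)
    then have "monomial m \<in> vs.span ((\<lambda>t. monomial (monom_of 1 t)) `
        {t \<in> ballot_lists n 0. sum_list t = sum_list (map (Poly_Mapping.lookup m) [1..<Suc n])}
        \<union> qsym_ideal n)"
      using monomial_in_span_ballot[of "map (Poly_Mapping.lookup m) [1..<Suc n]" n]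
      by (simp del: upt_Suc)
    then show "monomial m \<in> vs.span ?S"
      by (rule rev_subsetD) (intro vs.span_mono Un_mono image_mono; blast)
  qed
qed

section \<open>Counting ballot lists\<close>

lemma ballot_lists_Suc:
  "ballot_lists (Suc m) c = (\<Union>a\<le>c. Cons a ` ballot_lists m (Suc c - a))"
proof -
  have "s \<in> ballot_lists (Suc m) c \<longleftrightarrow> s \<in> (\<Union>a\<le>c. Cons a ` ballot_lists m (Suc c - a))" for s
    by (cases s) (auto simp: ballot_lists_def)
  then show ?thesis by blast
qed

lemma finite_ballot_lists: "finite (ballot_lists m c)"
proof (induction m arbitrary: c)
  case 0
  then show ?case by (simp add: ballot_lists_def)
qed (simp add: ballot_lists_Suc)

lemma card_ballot_lists_Suc:
  "card (ballot_lists (Suc m) c) = (\<Sum>a\<le>c. card (ballot_lists m (Suc c - a)))"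
  unfolding ballot_lists_Suc
  by (subst card_UN_disjoint) (auto simp: finite_ballot_lists card_image)

lemma card_ballot_lists_0: "card (ballot_lists 0 c) = 1"
proof -
  have "ballot_lists 0 c = {[]}" by (auto simp: ballot_lists_def)
  then show ?thesis by simp
qed

text \<open>The difference of two binomials known from the reflection principle, written as a sum to
  stay in the natural numbers. Both inductions reduce to Pascal's rule.\<close>

lemma card_ballot_lists:
  "card (ballot_lists (Suc m) c) + ((2 * m + 2 + c) choose m) = (2 * m + 2 + c) choose Suc m"
proof (induction m arbitrary: c)
  case 0
  have "card (ballot_lists (Suc 0) c) = Suc c"
    by (simp add: card_ballot_lists_Suc card_ballot_lists_0)
  then show ?case by simp
next
  case (Suc m)
  show ?case
  proof (induction c)
    case 0
    \<comment> \<open>With \<open>c = 0\<close> the first entry must be 0, which leaves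
      \<open>c = 1\<close> for the tail.\<close>
    have "card (ballot_lists (Suc (Suc m)) 0) = card (ballot_lists (Suc m) 1)"
      by (simp add: card_ballot_lists_Suc[of "Suc m"])
    moreover have "(2 * m + 3) choose Suc (Suc m) = (2 * m + 3) choose Suc m"
      using binomial_symmetric[of "Suc m" "2 * m + 3"] by simp
    moreover have "2 * Suc m + 2 + 0 = Suc (2 * m + 3)" "2 * m + 2 + 1 = 2 * m + 3" by simp_all
    ultimately show ?case
      using Suc[of 1] by (simp only: binomial_Suc_Suc)
  next
    case (Suc c)
    \<comment> \<open>A first entry 0 gives the first summand; lowering a positive first entry by
      one gives the lists counted by the second.\<close>
    have "card (ballot_lists (Suc (Suc m)) (Suc c))
      = card (ballot_lists (Suc m) (Suc (Suc c))) + card (ballot_lists (Suc (Suc m)) c)"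
      unfolding card_ballot_lists_Suc[of "Suc m"] by (simp add: sum.atMost_Suc_shift del: sum.atMost_Suc)
    moreover have "2 * Suc m + 2 + Suc c = Suc (2 * m + 4 + c)"
      "2 * m + 2 + Suc (Suc c) = 2 * m + 4 + c" "2 * Suc m + 2 + c = 2 * m + 4 + c" by simp_all
    ultimately show ?case
      using Suc.IH \<open>\<And>c. card (ballot_lists (Suc m) c) + (2 * m + 2 + c choose m) =
         2 * m + 2 + c choose Suc m\<close>[of "Suc (Suc c)"]
      by (simp only: binomial_Suc_Suc)
  qed
qed

lemma card_ballot_lists_eq_catalan:
  assumes "1 \<le> n"
  shows "real (card (ballot_lists n 0)) = 1 / (real n + 1) * real ((2 * n) choose n)"
proof -
  obtain m where m: "n = Suc m" using assms by (cases n) auto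
  \<comment> \<open>Since \<open>m = n - 1\<close>, the first factor is \<open>n + 1\<close>; both
    absorption identities have the same right-hand side.\<close>
  have "(2 * n - m) * ((2 * n) choose m) = 2 * n * ((2 * n - 1) choose m)"
    by (rule binomial_absorb_comp)
  moreover have "n * ((2 * n) choose n) = 2 * n * ((2 * n - 1) choose m)"
    using Suc_times_binomial[of m "2 * n - 1"] m by simp
  ultimately have "(n + 1) * ((2 * n) choose m) = n * ((2 * n) choose n)"
    using m by simp
  then have "(real n + 1) * real ((2 * n) choose m) = real n * real ((2 * n) choose n)"
    by (metis of_nat_1 of_nat_add of_nat_mult)
  moreover have sum: "real ((2 * n) choose n) = real (card (ballot_lists n 0)) + real ((2 * n) choose m)"
    using card_ballot_lists[of m 0] m by (simp flip: of_nat_add)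
  ultimately have "(real n + 1) * real (card (ballot_lists n 0)) = real ((2 * n) choose n)"
    unfolding sum by (simp add: algebra_simps)
  then show ?thesis by (simp add: field_simps)
qed

section \<open>The scalar product\<close>

lemma lookup_const_mult: "Poly_Mapping.lookup (const c * p) m = c * Poly_Mapping.lookup p m"
proof -
  have "const c * p = Poly_Mapping.map ((*) c) p"
    by (simp add: const_def mult_map_scale_conv_mult)
  then show ?thesis
    by (simp add: map.rep_eq when_def)
qed

lemma lookup_partial:
  "Poly_Mapping.lookup (partial i q) m
    = of_nat (Suc (Poly_Mapping.lookup m i)) * Poly_Mapping.lookup q (m + Poly_Mapping.single i 1)"
proof -
  let ?m' = "m + Poly_Mapping.single i 1"
  have "Poly_Mapping.lookup (Poly_Mapping.single (l - Poly_Mapping.single i 1)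
      (of_nat (Poly_Mapping.lookup l i) * Poly_Mapping.lookup q l)) m
    = (if l = ?m' then of_nat (Suc (Poly_Mapping.lookup m i)) * Poly_Mapping.lookup q ?m' else 0)" for l
  proof (cases "l = ?m'")
    case True
    then show ?thesis by (simp add: lookup_add)
  next
    case False
    \<comment> \<open>Truncated subtraction can send another \<open>l\<close> to \<open>m\<close>
      only if \<open>l\<close> has exponent 0 at \<open>i\<close>, and then the coefficient
      vanishes.\<close>
    have "Poly_Mapping.lookup l i = 0" if "l - Poly_Mapping.single i 1 = m"
    proof (rule ccontr)
      assume "Poly_Mapping.lookup l i \<noteq> 0"
      then have "l = ?m'"
        unfolding that[symmetric]
        by (intro poly_mapping_eqI) (auto simp: lookup_add lookup_minus lookup_single when_def)
      with False show False ..
    qed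
    then show ?thesis using False by (auto simp: lookup_single when_def)
  qed
  then show ?thesis
    by (simp add: partial_def lookup_sum in_keys_iff)
qed

text \<open>The weight is a product of positive integers; what is recorded is that it is nonzero and
  independent of \<open>q\<close>.\<close>

lemma lookup_partial_power:
  "\<exists>w::rat. w \<noteq> 0 \<and> (\<forall>q. Poly_Mapping.lookup ((partial i ^^ k) q) m
    = w * Poly_Mapping.lookup q (m + Poly_Mapping.single i k))"
proof (induction k arbitrary: m)
  case 0
  then show ?case by (auto intro: exI[of _ 1])
next
  case (Suc k)
  obtain w :: rat where w: "w \<noteq> 0"
    "\<And>q. Poly_Mapping.lookup ((partial i ^^ k) q) (m + Poly_Mapping.single i 1)
      = w * Poly_Mapping.lookup q (m + Poly_Mapping.single i 1 + Poly_Mapping.single i k)"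
    using Suc by blast
  have "m + Poly_Mapping.single i 1 + Poly_Mapping.single i k = m + Poly_Mapping.single i (Suc k)"
    by (simp add: add.assoc flip: single_add)
  then show ?case
    using w by (intro exI[of _ "of_nat (Suc (Poly_Mapping.lookup m i)) * w"])
      (simp add: lookup_partial del: of_nat_Suc)
qed

lemma lookup_foldr_partial:
  "\<exists>w::rat. w \<noteq> 0 \<and> (\<forall>q. Poly_Mapping.lookup (foldr (\<lambda>i. partial i ^^ k i) xs q) m
    = w * Poly_Mapping.lookup q (m + (\<Sum>i\<leftarrow>xs. Poly_Mapping.single i (k i))))"
proof (induction xs arbitrary: m)
  case Nil
  then show ?case by (auto intro: exI[of _ 1])
next
  case (Cons i xs)
  obtain v :: rat where v: "v \<noteq> 0"
    "\<And>q. Poly_Mapping.lookup ((partial i ^^ k i) q) m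
      = v * Poly_Mapping.lookup q (m + Poly_Mapping.single i (k i))"
    using lookup_partial_power by blast
  obtain w :: rat where w: "w \<noteq> 0"
    "\<And>q. Poly_Mapping.lookup (foldr (\<lambda>i. partial i ^^ k i) xs q) (m + Poly_Mapping.single i (k i))
      = w * Poly_Mapping.lookup q (m + Poly_Mapping.single i (k i) + (\<Sum>i\<leftarrow>xs. Poly_Mapping.single i (k i)))"
    using Cons by blast
  show ?case
    using v w by (intro exI[of _ "v * w"]) (simp add: add.assoc)
qed

lemma lookup_monomial_diff_0:
  "\<exists>w::rat. w \<noteq> 0 \<and> (\<forall>q. Poly_Mapping.lookup (monomial_diff m q) 0 = w * Poly_Mapping.lookup q m)"
proof -
  have "(\<Sum>i\<leftarrow>sorted_list_of_set (Poly_Mapping.keys m). Poly_Mapping.single i (Poly_Mapping.lookup m i))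
    = (\<Sum>i\<in>Poly_Mapping.keys m. Poly_Mapping.single i (Poly_Mapping.lookup m i))"
    by (simp add: sum_list_distinct_conv_sum_set)
  also have "\<dots> = m"
    by (rule poly_mapping_eqI) (simp add: lookup_sum lookup_single when_def in_keys_iff)
  finally show ?thesis
    using lookup_foldr_partial[of "Poly_Mapping.lookup m" "sorted_list_of_set (Poly_Mapping.keys m)" 0]
    by (simp add: monomial_diff_def)
qed

lemma eval_0: "eval (\<lambda>_. 0) p = Poly_Mapping.lookup p 0"
proof -
  have prod: "(\<Prod>i\<in>Poly_Mapping.keys m. (0::rat) ^ Poly_Mapping.lookup m i) = (if m = 0 then 1 else 0)" for m
  proof (cases "m = 0")
    case False
    then obtain i where "i \<in> Poly_Mapping.keys m"
      by (metis keys_eq_empty equals0I)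
    then show ?thesis
      using False by (auto intro!: prod_zero bexI[of _ i] simp: in_keys_iff)
  qed simp
  show ?thesis
    unfolding eval_def prod by (simp add: in_keys_iff if_distrib[of "\<lambda>x. _ * x"] cong: if_cong)
qed

text \<open>Distinct monomials are orthogonal, and the weight of a monomial is the product of the
  factorials of its exponents. Linearity and nondegeneracy are read off from this form.\<close>

lemma scalar_product_diagonal:
  obtains w :: "(nat \<Rightarrow>\<^sub>0 nat) \<Rightarrow> rat" where "\<And>m. w m \<noteq> 0"
    "\<And>p q. scalar_product p q
      = (\<Sum>m\<in>Poly_Mapping.keys p. Poly_Mapping.lookup p m * (w m * Poly_Mapping.lookup q m))"
proof -
  obtain w :: "(nat \<Rightarrow>\<^sub>0 nat) \<Rightarrow> rat" where w: "\<And>m. w m \<noteq> 0"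
    "\<And>m q. Poly_Mapping.lookup (monomial_diff m q) 0 = w m * Poly_Mapping.lookup q m"
    using lookup_monomial_diff_0 by metis
  show thesis
    by (rule that[of w, OF w(1)])
      (simp add: scalar_product_def eval_0 diff_op_def lookup_sum lookup_const_mult w(2))
qed

lemma subspace_scalar_product_right: "vs.subspace {q. scalar_product p q = 0}"
proof -
  obtain w where w: "\<And>p q. scalar_product p q
      = (\<Sum>m\<in>Poly_Mapping.keys p. Poly_Mapping.lookup p m * (w m * Poly_Mapping.lookup q m))"
    using scalar_product_diagonal by metis
  show ?thesis
  proof (rule vs.subspaceI)
    fix c q assume "q \<in> {q. scalar_product p q = 0}"
    moreover have "scalar_product p (const c * q) = c * scalar_product p q"
      by (simp add: w lookup_const_mult sum_distrib_left mult.left_commute)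
    ultimately show "const c * q \<in> {q. scalar_product p q = 0}" by simp
  qed (simp_all add: w lookup_add distrib_left sum.distrib)
qed

lemma subspace_scalar_product_left: "vs.subspace {p. scalar_product p q = 0}"
proof -
  obtain w where w: "\<And>p q. scalar_product p q
      = (\<Sum>m\<in>Poly_Mapping.keys p. Poly_Mapping.lookup p m * (w m * Poly_Mapping.lookup q m))"
    using scalar_product_diagonal by metis
  \<comment> \<open>Summing over the keys of the fixed \<open>q\<close> gives an index set
    independent of \<open>p\<close>, so linearity in \<open>p\<close> becomes visible.\<close>
  have eq: "scalar_product p q
      = (\<Sum>m\<in>Poly_Mapping.keys q. Poly_Mapping.lookup p m * (w m * Poly_Mapping.lookup q m))" for p
    unfolding w by (rule sum.mono_neutral_cong) (auto simp: in_keys_iff)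
  show ?thesis
  proof (rule vs.subspaceI)
    fix c p assume "p \<in> {p. scalar_product p q = 0}"
    moreover have "scalar_product (const c * p) q = c * scalar_product p q"
      by (simp add: eq lookup_const_mult sum_distrib_left mult.assoc)
    ultimately show "const c * p \<in> {p. scalar_product p q = 0}" by simp
  qed (simp_all add: eq lookup_add distrib_right sum.distrib)
qed

lemma scalar_product_nondegenerate:
  assumes "q \<in> carrier (poly_ring n)" "\<And>p. p \<in> carrier (poly_ring n) \<Longrightarrow> scalar_product p q = 0"
  shows "q = 0"
proof (rule ccontr)
  assume "q \<noteq> 0"
  then obtain m where m: "m \<in> Poly_Mapping.keys q" by (metis keys_eq_empty equals0I)
  obtain w where w: "\<And>m. w m \<noteq> 0" "\<And>p q. scalar_product p q
      = (\<Sum>m\<in>Poly_Mapping.keys p. Poly_Mapping.lookup p m * (w m * Poly_Mapping.lookup q m))"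
    using scalar_product_diagonal by metis
  have "scalar_product (monomial m) q = w m * Poly_Mapping.lookup q m"
    by (simp add: w(2) monomial_def)
  moreover have "monomial m \<in> carrier (poly_ring n)"
    using m assms(1) by (simp add: mem_poly_ring monomial_def)
  ultimately show False
    using assms(2)[of "monomial m"] w(1)[of m] m by (simp add: in_keys_iff)
qed

section \<open>Dimensions\<close>

lemma subspace_poly_ring: "vs.subspace (carrier (poly_ring n))"
  by (rule vs.subspaceI) (simp_all add: poly_ring_closed const_in_poly_ring)

text \<open>Bridge from spans in the vector space of all polynomials to
  \<open>ring.dimension\<close>, adding one basis element at a time. It is applied to the coset map
  for the quotient and to the identity for the super-harmonic polynomials.\<close>

lemma dimension_hom_span:
  assumes "ring_hom_ring (poly_ring n) S h" "finite B" "B \<subseteq> carrier (poly_ring n)"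
    and "\<And>b. b \<in> B \<Longrightarrow> h b \<notin> h ` vs.span (B - {b})"
  shows "ring.dimension S (card B) (h ` constants) (h ` vs.span B)"
  using assms(2-4)
proof (induction B)
  case empty
  interpret h: ring_hom_ring "poly_ring n" S h by fact
  have "h ` vs.span {} = {\<zero>\<^bsub>S\<^esub>}"
    using h.hom_zero by (simp add: poly_ring_ops)
  then show ?case by simp
next
  case (insert b B)
  interpret h: ring_hom_ring "poly_ring n" S h by fact
  have sub: "vs.span B \<subseteq> carrier (poly_ring n)"
    using insert.prems(1) by (intro vs.span_minimal subspace_poly_ring) auto
  have b: "b \<in> carrier (poly_ring n)" using insert.prems(1) by simp
  have "h b' \<notin> h ` vs.span (B - {b'})" if "b' \<in> B" for b'
  proof -
    have "vs.span (B - {b'}) \<subseteq> vs.span (insert b B - {b'})"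
      by (intro vs.span_mono) blast
    then show ?thesis using insert.prems(2)[of b'] that by blast
  qed
  then have IH: "h.S.dimension (card B) (h ` constants) (h ` vs.span B)"
    using insert.prems(1) by (intro insert.IH) auto
  have "h b \<notin> h ` vs.span B"
    using insert.prems(2)[of b] insert.hyps(2) by simp
  with IH have "h.S.dimension (Suc (card B)) (h ` constants)
      (h.S.line_extension (h ` constants) (h b) (h ` vs.span B))"
    using b by (intro h.S.dimension.Suc_dim) auto
  moreover have "h.S.line_extension (h ` constants) (h b) (h ` vs.span B) = h ` vs.span (insert b B)"
  proof -
    have hom: "h (const c) \<otimes>\<^bsub>S\<^esub> h b \<oplus>\<^bsub>S\<^esub> h v = h (const c * b + v)" if "v \<in> vs.span B" for c v
    proof -
      have v: "v \<in> carrier (poly_ring n)" using that sub by blast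
      then show ?thesis
        using b h.hom_mult[OF const_in_poly_ring b, of c] poly_ring_closed(5)[OF const_in_poly_ring b]
          h.hom_add[of "const c * b" v]
        by (simp add: poly_ring_ops)
    qed
    have span: "vs.span (insert b B) = {const c * b + v | c v. v \<in> vs.span B}"
    proof (intro subset_antisym subsetI)
      fix x assume "x \<in> vs.span (insert b B)"
      then obtain c where "x - const c * b \<in> vs.span B"
        unfolding vs.span_breakdown_eq by blast
      then show "x \<in> {const c * b + v | c v. v \<in> vs.span B}"
        by (intro CollectI exI[of _ c] exI[of _ "x - const c * b"]) simp
    next
      fix x assume "x \<in> {const c * b + v | c v. v \<in> vs.span B}"
      then obtain c v where "x = const c * b + v" "v \<in> vs.span B" by blast
      then show "x \<in> vs.span (insert b B)"
        unfolding vs.span_breakdown_eq by (intro exI[of _ c]) simp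
    qed
    have "h.S.line_extension (h ` constants) (h b) (h ` vs.span B)
      = {h (const c) \<otimes>\<^bsub>S\<^esub> h b \<oplus>\<^bsub>S\<^esub> h v | c v. v \<in> vs.span B}"
      unfolding set_eq_iff h.S.line_extension_mem_iff constants_def by blast
    also have "\<dots> = {h (const c * b + v) | c v. v \<in> vs.span B}"
      by (intro Collect_cong ex_cong1 iffI) (auto simp: hom)
    also have "\<dots> = h ` vs.span (insert b B)"
      unfolding span by blast
    finally show ?thesis .
  qed
  ultimately show ?case
    using insert.hyps by simp
qed

section \<open>A basis of the quotient\<close>

lemma qsym_coset_eq_iff:
  assumes "p \<in> carrier (poly_ring n)" "q \<in> carrier (poly_ring n)"
  shows "qsym_ideal n +>\<^bsub>poly_ring n\<^esub> p = qsym_ideal n +>\<^bsub>poly_ring n\<^esub> q \<longleftrightarrow> p - q \<in> qsym_ideal n"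
proof -
  interpret cring "poly_ring n" by (rule cring_poly_ring)
  have "p \<ominus>\<^bsub>poly_ring n\<^esub> q = p - q"
    using assms by (simp add: a_minus_def a_inv_poly_ring poly_ring_ops)
  then show ?thesis
    using quotient_eq_iff_same_a_r_cos[OF ideal_qsym_ideal assms] by simp
qed

text \<open>A basis \<open>A\<close> of the ideal is enlarged by ballot monomials to a basis of the
  polynomial ring; \<open>B\<close> consists of the monomials added. Independence of all ballot
  monomials is not claimed, hence the inequality.\<close>

lemma basis_modulo_ideal:
  obtains A B where "vs.span A = qsym_ideal n" "vs.independent (A \<union> B)" "A \<inter> B = {}"
    "vs.span (A \<union> B) = carrier (poly_ring n)" "finite B" "card B \<le> card (ballot_lists n 0)"
proof -
  let ?M = "(\<lambda>t. monomial (monom_of 1 t)) ` ballot_lists n 0"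
  obtain A where A: "A \<subseteq> qsym_ideal n" "vs.independent A" "qsym_ideal n \<subseteq> vs.span A"
    by (rule vs.basis_exists)
  have span_A: "vs.span A = qsym_ideal n"
    using A vs.span_minimal[OF A(1) subspace_qsym_ideal] by blast
  obtain C where C: "A \<subseteq> C" "C \<subseteq> A \<union> ?M" "vs.independent C" "A \<union> ?M \<subseteq> vs.span C"
    using vs.maximal_independent_subset_extend[OF Un_upper1 A(2)] by metis
  have M: "?M \<subseteq> carrier (poly_ring n)"
    by (auto simp: mem_poly_ring monomial_def ballot_lists_def in_keys_iff lookup_monom_of
        split: if_splits)
  have "?M \<union> qsym_ideal n \<subseteq> vs.span C"
    using C(4) A(3) vs.span_mono[OF C(1)] by blast
  then have "vs.span (?M \<union> qsym_ideal n) \<subseteq> vs.span C"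
    by (rule vs.span_minimal) (rule vs.subspace_span)
  then have "carrier (poly_ring n) \<subseteq> vs.span C"
    using poly_ring_subset_span by blast
  moreover have "vs.span C \<subseteq> carrier (poly_ring n)"
    using A(1) C(2) M qsym_ideal_closed(5) by (intro vs.span_minimal subspace_poly_ring) blast
  ultimately have span_C: "vs.span C = carrier (poly_ring n)" by blast
  have "finite ?M" "C - A \<subseteq> ?M"
    using C(2) finite_ballot_lists by auto
  then have "card (C - A) \<le> card ?M" "finite (C - A)"
    by (rule card_mono, rule finite_subset[rotated])
  moreover have "card ?M \<le> card (ballot_lists n 0)"
    by (rule card_image_le) (rule finite_ballot_lists)
  ultimately show thesis
    using that[of A "C - A"] span_A span_C C(1,3) by (simp add: Un_absorb1)
qed

text \<open>The cosets of \<open>B\<close> form a basis: a relation among them lifts to one in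
  \<open>A \<union> B\<close>, and the \<open>A\<close>-component of a polynomial vanishes modulo
  the ideal.\<close>

lemma dimension_quotient:
  assumes "vs.span A = qsym_ideal n" "vs.independent (A \<union> B)" "A \<inter> B = {}"
    "vs.span (A \<union> B) = carrier (poly_ring n)" "finite B"
  shows "ring.dimension (qsym_quotient n) (card B) (quotient_constants n) (carrier (qsym_quotient n))"
proof -
  let ?h = "(+>\<^bsub>poly_ring n\<^esub>) (qsym_ideal n)"
  have hom: "ring_hom_ring (poly_ring n) (qsym_quotient n) ?h"
    unfolding qsym_quotient_def by (rule ideal.rcos_ring_hom_ring[OF ideal_qsym_ideal])
  have sub: "vs.span C \<subseteq> carrier (poly_ring n)" if "C \<subseteq> B" for C
    unfolding assms(4)[symmetric] using that by (intro vs.span_mono) blast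
  have B: "B \<subseteq> carrier (poly_ring n)"
    using sub[of B] vs.span_superset[of B] by blast
  have "?h b \<notin> ?h ` vs.span (B - {b})" if b: "b \<in> B" for b
  proof
    assume "?h b \<in> ?h ` vs.span (B - {b})"
    then obtain v where v: "v \<in> vs.span (B - {b})" "?h b = ?h v" by blast
    then have "b - v \<in> vs.span A"
      using qsym_coset_eq_iff[of b n v] b B sub[of "B - {b}"] assms(1) by blast
    moreover have "vs.span A \<subseteq> vs.span (A \<union> B - {b})"
      using assms(3) b by (intro vs.span_mono) blast
    moreover have "vs.span (B - {b}) \<subseteq> vs.span (A \<union> B - {b})"
      by (intro vs.span_mono) blast
    ultimately have "b - v + v \<in> vs.span (A \<union> B - {b})"
      using v(1) by (intro vs.span_add) blast+
    then show False
      using assms(2) b unfolding vs.dependent_def by auto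
  qed
  then have "ring.dimension (qsym_quotient n) (card B) (?h ` constants) (?h ` vs.span B)"
    using dimension_hom_span[OF hom assms(5) B] by blast
  moreover have "?h ` vs.span B = carrier (qsym_quotient n)"
  proof -
    have "?h ` carrier (poly_ring n) \<subseteq> ?h ` vs.span B"
    proof (rule image_subsetI)
      fix p assume p: "p \<in> carrier (poly_ring n)"
      obtain j v where jv: "p = j + v" "j \<in> vs.span A" "v \<in> vs.span B"
        using p unfolding assms(4)[symmetric] vs.span_Un by blast
      then have "?h p = ?h v"
        using qsym_coset_eq_iff[of p n v] p sub[of B] assms(1) by auto
      then show "?h p \<in> ?h ` vs.span B" using jv(3) by (rule image_eqI)
    qed
    moreover have "?h ` vs.span B \<subseteq> ?h ` carrier (poly_ring n)"
      using sub[of B] by (intro image_mono) simp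
    ultimately have "?h ` vs.span B = ?h ` carrier (poly_ring n)"
      by (rule subset_antisym[rotated])
    also have "\<dots> = carrier (qsym_quotient n)"
      by (auto simp: qsym_quotient_def FactRing_def A_RCOSETS_def')
    finally show ?thesis .
  qed
  ultimately show ?thesis
    by (simp add: quotient_constants_def)
qed

section \<open>The dual basis of super-harmonic polynomials\<close>

text \<open>The coordinate functional of \<open>b\<close> vanishes on the ideal, hence on all
  monomials of degree at least \<open>n\<close>. Its finitely many other values on monomials,
  divided by the weights, are the coefficients of a representing polynomial.\<close>

lemma functional_representation:
  assumes "1 \<le> n" "vs.span A = qsym_ideal n" "vs.independent (A \<union> B)" "A \<inter> B = {}"
    "vs.span (A \<union> B) = carrier (poly_ring n)" "b \<in> B"
  obtains q where "q \<in> carrier (poly_ring n)"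
    "\<And>p. p \<in> carrier (poly_ring n) \<Longrightarrow> scalar_product p q = vs.representation (A \<union> B) p b"
proof -
  let ?\<phi> = "\<lambda>p. vs.representation (A \<union> B) p b"
  obtain w where w: "\<And>m. w m \<noteq> 0" "\<And>p q. scalar_product p q
      = (\<Sum>m\<in>Poly_Mapping.keys p. Poly_Mapping.lookup p m * (w m * Poly_Mapping.lookup q m))"
    using scalar_product_diagonal by metis
  define T where "T = monom_of 1 ` {t. length t = n \<and> sum_list t < n}"
  define q where "q = (\<Sum>m\<in>T. const (?\<phi> (monomial m) / w m) * monomial m)"
  have "{t. length t = n \<and> sum_list t < n} \<subseteq> {t. set t \<subseteq> {..<n} \<and> length t = n}"
    using member_le_sum_list by (fastforce simp: subset_iff)
  then have fin: "finite T"
    unfolding T_def by (intro finite_imageI) (rule finite_subset, auto intro: finite_lists_length_eq)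
  have lookup_q: "Poly_Mapping.lookup q m = (if m \<in> T then ?\<phi> (monomial m) / w m else 0)" for m
    using fin by (simp add: q_def lookup_sum lookup_const_mult monomial_def lookup_single when_def
        if_distrib[of "\<lambda>x. _ * x"] cong: if_cong)
  \<comment> \<open>Elements of the ideal are represented by \<open>A\<close> alone, and
    \<open>b\<close> is not in \<open>A\<close>.\<close>
  have vanish: "?\<phi> p = 0" if "p \<in> qsym_ideal n" for p
  proof -
    have "vs.representation (A \<union> B) p = vs.representation A p"
      using assms(2,3) that by (intro vs.representation_extend) auto
    then show ?thesis
      using vs.representation_ne_zero[of A p b] assms(4,6) by auto
  qed
  have coeff: "w m * Poly_Mapping.lookup q m = ?\<phi> (monomial m)" if "Poly_Mapping.keys m \<subseteq> {1..n}" for m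
  proof (cases "m \<in> T")
    case True
    then show ?thesis using w(1) by (simp add: lookup_q)
  next
    case False
    let ?t = "map (Poly_Mapping.lookup m) [1..<Suc n]"
    have t: "monom_of 1 ?t = m" using that by (rule monom_of_lookup)
    have len: "length ?t = n" by simp
    have "\<not> sum_list ?t < n"
      using False t len unfolding T_def by (metis (mono_tags, lifting) image_eqI mem_Collect_eq)
    then have "monomial m \<in> qsym_ideal n"
      using high_monomial_in_ideal[OF len assms(1)] t by (simp del: upt_Suc)
    then show ?thesis using False vanish by (simp add: lookup_q)
  qed
  show thesis
  proof (rule that)
    show "q \<in> carrier (poly_ring n)"
      unfolding mem_poly_ring
    proof
      fix m assume "m \<in> Poly_Mapping.keys q"
      then have "m \<in> T" by (auto simp: in_keys_iff lookup_q split: if_splits)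
      then show "Poly_Mapping.keys m \<subseteq> {1..n}"
        by (auto simp: T_def in_keys_iff lookup_monom_of split: if_splits)
    qed
    fix p assume p: "p \<in> carrier (poly_ring n)"
    then have keys: "Poly_Mapping.keys m \<subseteq> {1..n}" if "m \<in> Poly_Mapping.keys p" for m
      using that by (simp add: mem_poly_ring)
    then have mon: "monomial m \<in> vs.span (A \<union> B)" if "m \<in> Poly_Mapping.keys p" for m
      using that assms(5) by (simp add: mem_poly_ring monomial_def)
    have "scalar_product p q = (\<Sum>m\<in>Poly_Mapping.keys p. Poly_Mapping.lookup p m * ?\<phi> (monomial m))"
      unfolding w(2) using coeff keys by (intro sum.cong) auto
    also have "\<dots> = ?\<phi> (\<Sum>m\<in>Poly_Mapping.keys p. const (Poly_Mapping.lookup p m) * monomial m)"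
      using assms(3) mon
      by (simp add: vs.representation_sum vs.representation_scale vs.span_scale)
    also have "\<dots> = ?\<phi> p"
      using poly_eq_sum_monomials[of p] by simp
    finally show "scalar_product p q = ?\<phi> p" .
  qed
qed

text \<open>The polynomials representing the coordinate functionals of \<open>B\<close> form a basis
  dual to \<open>B\<close>.\<close>

lemma dimension_super_harmonic:
  assumes "1 \<le> n" "vs.span A = qsym_ideal n" "vs.independent (A \<union> B)" "A \<inter> B = {}"
    "vs.span (A \<union> B) = carrier (poly_ring n)" "finite B"
  shows "ring.dimension (poly_ring n) (card B) constants (super_harmonic n)"
proof -
  have "\<exists>q. q \<in> carrier (poly_ring n) \<and> (\<forall>p\<in>carrier (poly_ring n).
      scalar_product p q = vs.representation (A \<union> B) p b)" if "b \<in> B" for b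
    using functional_representation[OF assms(1-5) that] by metis
  then obtain q where q: "\<And>b. b \<in> B \<Longrightarrow> q b \<in> carrier (poly_ring n)"
    "\<And>b p. b \<in> B \<Longrightarrow> p \<in> carrier (poly_ring n) \<Longrightarrow>
      scalar_product p (q b) = vs.representation (A \<union> B) p b"
    by metis
  have AB: "A \<subseteq> carrier (poly_ring n)" "B \<subseteq> carrier (poly_ring n)"
    using vs.span_superset[of "A \<union> B"] assms(5) by auto
  have dual: "scalar_product b' (q b) = (if b' = b then 1 else 0)" if "b \<in> B" "b' \<in> A \<union> B" for b b'
    using that AB q(2)[of b b'] assms(3) by (auto simp: vs.representation_basis)
  have inj: "inj_on q B"
  proof (rule inj_onI)
    fix b b' assume "b \<in> B" "b' \<in> B" "q b = q b'"
    then show "b = b'" using dual[of b b] dual[of b' b] by (auto split: if_splits)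
  qed
  have subspace: "vs.subspace (super_harmonic n)"
  proof -
    have "super_harmonic n
      = carrier (poly_ring n) \<inter> (\<Inter>p\<in>qsym_ideal n. {q. scalar_product p q = 0})"
      by (auto simp: super_harmonic_def)
    then show ?thesis
      using subspace_poly_ring subspace_scalar_product_right
      by (auto intro!: vs.subspace_inter vs.subspace_Inter)
  qed
  have harmonic: "r \<in> super_harmonic n"
    if r: "r \<in> carrier (poly_ring n)" "\<And>a. a \<in> A \<Longrightarrow> scalar_product a r = 0" for r
  proof -
    have "vs.span A \<subseteq> {p. scalar_product p r = 0}"
      using r(2) by (intro vs.span_minimal subspace_scalar_product_left) auto
    then show ?thesis
      using r(1) assms(2) by (auto simp: super_harmonic_def)
  qed
  have q_harmonic: "q ` B \<subseteq> super_harmonic n"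
    using harmonic q(1) dual assms(4) by fastforce
  have "vs.span (q ` B) = super_harmonic n"
  proof
    show "vs.span (q ` B) \<subseteq> super_harmonic n"
      using q_harmonic subspace by (rule vs.span_minimal)
    show "super_harmonic n \<subseteq> vs.span (q ` B)"
    proof
      fix r assume r: "r \<in> super_harmonic n"
      \<comment> \<open>The expansion of \<open>r\<close> in the dual basis: \<open>r - s\<close>
        pairs to 0 with \<open>A\<close> because both are super-harmonic and with \<open>B\<close>
        by duality, hence is 0 by nondegeneracy.\<close>
      define s where "s = (\<Sum>b\<in>B. const (scalar_product b r) * q b)"
      have s_span: "s \<in> vs.span (q ` B)"
        unfolding s_def by (intro vs.span_sum vs.span_scale vs.span_base) auto
      then have s: "s \<in> super_harmonic n"
        using q_harmonic subspace vs.span_minimal by blast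
      obtain w where w: "\<And>p q. scalar_product p q
          = (\<Sum>m\<in>Poly_Mapping.keys p. Poly_Mapping.lookup p m * (w m * Poly_Mapping.lookup q m))"
        using scalar_product_diagonal by metis
      have diff: "scalar_product p (x - y) = scalar_product p x - scalar_product p y" for p x y
        by (simp add: w lookup_minus right_diff_distrib sum_subtractf)
      have sum: "scalar_product p s = (\<Sum>b\<in>B. scalar_product b r * scalar_product p (q b))" for p
      proof -
        have "scalar_product p s = (\<Sum>m\<in>Poly_Mapping.keys p. \<Sum>b\<in>B.
            scalar_product b r * (Poly_Mapping.lookup p m * (w m * Poly_Mapping.lookup (q b) m)))"
          unfolding w[of p s]
          by (simp add: s_def lookup_sum lookup_const_mult sum_distrib_left mult.left_commute)
        then show ?thesis
          by (subst (asm) sum.swap) (simp add: w[of p "q _"] sum_distrib_left)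
      qed
      have "scalar_product c (r - s) = 0" if "c \<in> A \<union> B" for c
      proof (cases "c \<in> A")
        case True
        then have "c \<in> qsym_ideal n" using assms(2) vs.span_superset[of A] by blast
        then show ?thesis
          using r s by (simp add: diff super_harmonic_def)
      next
        case False
        then have c: "c \<in> B" using that by blast
        have "scalar_product c s = (\<Sum>b\<in>B. if b = c then scalar_product b r else 0)"
          unfolding sum using dual that by (intro sum.cong) auto
        also have "\<dots> = scalar_product c r"
          using c assms(6) by simp
        finally show ?thesis by (simp add: diff)
      qed
      then have "vs.span (A \<union> B) \<subseteq> {p. scalar_product p (r - s) = 0}"
        by (intro vs.span_minimal subspace_scalar_product_left) auto
      moreover have "r - s \<in> carrier (poly_ring n)"
        using vs.subspace_diff[OF subspace r s] by (simp add: super_harmonic_def)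
      ultimately have "r - s = 0"
        using assms(5) by (intro scalar_product_nondegenerate) auto
      then show "r \<in> vs.span (q ` B)" using s_span by simp
    qed
  qed
  moreover have "ring.dimension (poly_ring n) (card (q ` B)) ((\<lambda>x. x) ` constants) ((\<lambda>x. x) ` vs.span (q ` B))"
  proof (rule dimension_hom_span)
    show "ring_hom_ring (poly_ring n) (poly_ring n) (\<lambda>x. x)"
      using cring_poly_ring[of n] by (intro ring_hom_ringI) (auto intro: cring.axioms(1))
    show "q ` B \<subseteq> carrier (poly_ring n)" using q(1) by blast
    show "x \<notin> (\<lambda>x. x) ` vs.span (q ` B - {x})" if x: "x \<in> q ` B" for x
    proof -
      obtain b where b: "b \<in> B" "x = q b" using x by blast
      \<comment> \<open>Pairing with \<open>b\<close> kills every other dual basis element but takes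
        the value 1 at \<open>q b\<close>.\<close>
      have "vs.span (q ` B - {x}) \<subseteq> {r. scalar_product b r = 0}"
        using b dual by (intro vs.span_minimal subspace_scalar_product_right) auto
      moreover have "scalar_product b x \<noteq> 0" using b dual[of b b] by simp
      ultimately show ?thesis by auto
    qed
  qed (use assms(6) in simp)
  ultimately show ?thesis
    using inj by (simp add: card_image)
qed

theorem theorem1p2:
  fixes n :: nat
  assumes "n \<ge> 1"
  shows "ring.finite_dimension (poly_ring n) constants (super_harmonic n) \<and>
    ring.finite_dimension (qsym_quotient n) (quotient_constants n) (carrier (qsym_quotient n)) \<and>
    ring.dim (poly_ring n) constants (super_harmonic n)
      = ring.dim (qsym_quotient n) (quotient_constants n) (carrier (qsym_quotient n)) \<and>
    real (ring.dim (qsym_quotient n) (quotient_constants n) (carrier (qsym_quotient n)))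
      \<le> 1 / (real n + 1) * real ((2 * n) choose n)"
proof -
  obtain A B where AB: "vs.span A = qsym_ideal n" "vs.independent (A \<union> B)" "A \<inter> B = {}"
    "vs.span (A \<union> B) = carrier (poly_ring n)" "finite B" "card B \<le> card (ballot_lists n 0)"
    by (rule basis_modulo_ideal)
  interpret P: cring "poly_ring n" by (rule cring_poly_ring)
  interpret Q: ring "qsym_quotient n"
    unfolding qsym_quotient_def by (rule ideal.quotient_is_ring[OF ideal_qsym_ideal])
  \<comment> \<open>The same set \<open>B\<close> measures both dimensions, which proves their
    equality; its bound by the ballot count gives the inequality.\<close>
  note dimP = dimension_super_harmonic[OF assms AB(1-5)]
  note dimQ = dimension_quotient[OF AB(1-5)]
  have "P.dim constants (super_harmonic n) = card B"
    using P.dimI[OF subfield_constants dimP] by (simp add: over_def)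
  moreover have "Q.dim (quotient_constants n) (carrier (qsym_quotient n)) = card B"
    using Q.dimI[OF subfield_quotient_constants dimQ] by (simp add: over_def)
  ultimately show ?thesis
    using P.finite_dimensionI[OF dimP] Q.finite_dimensionI[OF dimQ] AB(6)
    unfolding card_ballot_lists_eq_catalan[OF assms, symmetric] by simp
qed

end
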